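(* Let $a$ be a non-zero integer and let $E_a/\mathbb{Q}$ be the elliptic curve $y^2=x^3+ax$. If $P\in E_a(\mathbb{Q})$ is a nontorsion point, then $$\widehat{h}(P) > \frac{1}{48}\log\left(\mathcal{D}_{E_a}\right)-\frac{\log 2}{4}.$$
   Context: $\mathcal{D}_{E_a}$ denotes the minimal discriminant of $E_a/\mathbb{Q}$, taken as a positive integer: the absolute value of the discriminant of a global minimal Weierstrass equation for $E_a$ over $\mathbb{Q}$. For a rational number $s/t$ in lowest terms, $h(s/t)=\log\max\{|s|,|t|\}$. For a point $P\in E_a(\mathbb{Q})$, $P\neq O$, put $h(P)=h(x(P))$, and $h(O)=0$. The canonical height is normalised as $\widehat{h}(P)=\frac12\lim_{n\to\infty} 4^{-n}h(2^nP)$. *)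

theory Defs
  imports Complex_Main "HOL-Computational_Algebra.Primes"
begin

text \<open>The general Weierstrass equation
  \<open>y\<^sup>2 + a\<^sub>1 x y + a\<^sub>3 y = x\<^sup>3 + a\<^sub>2 x\<^sup>2 + a\<^sub>4 x + a\<^sub>6\<close>;
  all formulas below follow the notation of Silverman's
  \<^emph>\<open>The Arithmetic of Elliptic Curves\<close>, Chapter III.\<close>

record 'a weierstrass =
  wa1 :: 'a
  wa2 :: 'a
  wa3 :: 'a
  wa4 :: 'a
  wa6 :: 'a

definition wb2 :: "'a::field weierstrass \<Rightarrow> 'a" where
  "wb2 W = (wa1 W)^2 + 4 * wa2 W"

definition wb4 :: "'a::field weierstrass \<Rightarrow> 'a" where
  "wb4 W = 2 * wa4 W + wa1 W * wa3 W"

definition wb6 :: "'a::field weierstrass \<Rightarrow> 'a" where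
  "wb6 W = (wa3 W)^2 + 4 * wa6 W"

definition wb8 :: "'a::field weierstrass \<Rightarrow> 'a" where
  "wb8 W = (wa1 W)^2 * wa6 W + 4 * wa2 W * wa6 W - wa1 W * wa3 W * wa4 W
     + wa2 W * (wa3 W)^2 - (wa4 W)^2"

definition discriminant :: "'a::field weierstrass \<Rightarrow> 'a" where
  "discriminant W = - ((wb2 W)^2) * wb8 W - 8 * (wb4 W)^3 - 27 * (wb6 W)^2
     + 9 * wb2 W * wb4 W * wb6 W"

definition curve_E :: "int \<Rightarrow> rat weierstrass" where
  "curve_E a = \<lparr>wa1 = 0, wa2 = 0, wa3 = 0, wa4 = of_int a, wa6 = 0\<rparr>"

lemma discriminant_curve_E: "discriminant (curve_E a) = - 64 * of_int a ^ 3"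
  by (simp add: discriminant_def curve_E_def wb2_def wb4_def wb6_def wb8_def
      power_mult_distrib)


subsection \<open>Points and the group law\<close>

datatype 'a point = Infinity | Affine 'a 'a

fun on_curve :: "'a::field weierstrass \<Rightarrow> 'a point \<Rightarrow> bool" where
  "on_curve W Infinity \<longleftrightarrow> True"
| "on_curve W (Affine x y) \<longleftrightarrow>
     y^2 + wa1 W * x * y + wa3 W * y = x^3 + wa2 W * x^2 + wa4 W * x + wa6 W"

definition curve_points :: "'a::field weierstrass \<Rightarrow> 'a point set" where
  "curve_points W = {P. on_curve W P}"

text \<open>In the last two cases \<open>y = l x + n\<close> is the chord through the two points, respectively
  the tangent line at the common point.\<close>

fun point_add :: "'a::field weierstrass \<Rightarrow> 'a point \<Rightarrow> 'a point \<Rightarrow> 'a point" where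
  "point_add W Infinity Q = Q"
| "point_add W P Infinity = P"
| "point_add W (Affine x1 y1) (Affine x2 y2) =
    (if x1 = x2 \<and> y1 + y2 + wa1 W * x2 + wa3 W = 0 then Infinity
     else
       let l = (if x1 \<noteq> x2 then (y2 - y1) / (x2 - x1)
                else (3 * x1^2 + 2 * wa2 W * x1 + wa4 W - wa1 W * y1)
                       / (2 * y1 + wa1 W * x1 + wa3 W));
           n = y1 - l * x1;
           x3 = l^2 + wa1 W * l - wa2 W - x1 - x2
       in Affine x3 (- (l + wa1 W) * x3 - n - wa3 W))"

primrec point_mult :: "'a::field weierstrass \<Rightarrow> nat \<Rightarrow> 'a point \<Rightarrow> 'a point" where
  "point_mult W 0 P = Infinity"
| "point_mult W (Suc n) P = point_add W P (point_mult W n P)"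

definition torsion_point :: "'a::field weierstrass \<Rightarrow> 'a point \<Rightarrow> bool" where
  "torsion_point W P \<longleftrightarrow> (\<exists>n>0. point_mult W n P = Infinity)"


subsection \<open>The minimal discriminant over the rationals\<close>

text \<open>The substitution \<open>x = u\<^sup>2 x' + r\<close>, \<open>y = u\<^sup>3 y' + u\<^sup>2 s x' + t\<close> gives
  an equation in \<open>x'\<close>, \<open>y'\<close> with the following coefficients.\<close>

definition change_vars ::
  "'a::field \<Rightarrow> 'a \<Rightarrow> 'a \<Rightarrow> 'a \<Rightarrow> 'a weierstrass \<Rightarrow> 'a weierstrass" where
  "change_vars u r s t W =
    \<lparr>wa1 = (wa1 W + 2 * s) / u,
     wa2 = (wa2 W - s * wa1 W + 3 * r - s^2) / u^2,
     wa3 = (wa3 W + r * wa1 W + 2 * t) / u^3,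
     wa4 = (wa4 W - s * wa3 W + 2 * r * wa2 W - (t + r * s) * wa1 W + 3 * r^2 - 2 * s * t) / u^4,
     wa6 = (wa6 W + r * wa4 W + r^2 * wa2 W + r^3 - t * wa3 W - t^2 - r * t * wa1 W) / u^6\<rparr>"

text \<open>\<open>W'\<close> is a Weierstrass equation of the curve given by \<open>W\<close>, over the same field.\<close>

definition weierstrass_model :: "'a::field weierstrass \<Rightarrow> 'a weierstrass \<Rightarrow> bool" where
  "weierstrass_model W W' \<longleftrightarrow> (\<exists>u r s t. u \<noteq> 0 \<and> W' = change_vars u r s t W)"

text \<open>Only meaningful for \<open>q \<noteq> 0\<close>: the value at \<open>0\<close> is \<open>0\<close> rather than infinity.\<close>

definition padic_val :: "nat \<Rightarrow> rat \<Rightarrow> int" where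
  "padic_val p q = int (multiplicity (int p) (fst (quotient_of q)))
                 - int (multiplicity (int p) (snd (quotient_of q)))"

definition padic_integral :: "nat \<Rightarrow> rat \<Rightarrow> bool" where
  "padic_integral p q \<longleftrightarrow> \<not> int p dvd snd (quotient_of q)"

definition wcoeffs :: "'a weierstrass \<Rightarrow> 'a set" where
  "wcoeffs W = {wa1 W, wa2 W, wa3 W, wa4 W, wa6 W}"

definition minimal_model_at :: "nat \<Rightarrow> rat weierstrass \<Rightarrow> rat weierstrass \<Rightarrow> bool" where
  "minimal_model_at p W M \<longleftrightarrow>
     weierstrass_model W M \<and> (\<forall>c\<in>wcoeffs M. padic_integral p c) \<and>
     (\<forall>M'. weierstrass_model W M' \<and> (\<forall>c\<in>wcoeffs M'. padic_integral p c) \<longrightarrow>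
        padic_val p (discriminant M) \<le> padic_val p (discriminant M'))"

definition global_minimal_model :: "rat weierstrass \<Rightarrow> rat weierstrass \<Rightarrow> bool" where
  "global_minimal_model W M \<longleftrightarrow>
     weierstrass_model W M \<and> wcoeffs M \<subseteq> \<int> \<and> (\<forall>p. prime p \<longrightarrow> minimal_model_at p W M)"

text \<open>The description is proper: over the rationals every elliptic curve has a global minimal
  equation, and any two of them have the same discriminant.\<close>

definition minimal_discriminant :: "rat weierstrass \<Rightarrow> nat" where
  "minimal_discriminant W =
     (THE d. \<exists>M. global_minimal_model W M \<and> of_nat d = \<bar>discriminant M\<bar>)"


subsection \<open>Heights\<close>

definition rat_height :: "rat \<Rightarrow> real" where
  "rat_height q = (case quotient_of q of (s, t) \<Rightarrow> ln (real_of_int (max \<bar>s\<bar> \<bar>t\<bar>)))"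

fun point_height :: "rat point \<Rightarrow> real" where
  "point_height Infinity = 0"
| "point_height (Affine x y) = rat_height x"

definition canonical_height :: "rat weierstrass \<Rightarrow> rat point \<Rightarrow> real" where
  "canonical_height W P =
     1 / 2 * lim (\<lambda>n. point_height (point_mult W (2 ^ n) P) / 4 ^ n)"

end

theory Submission imports Defs begin

text \<open>Write \<open>a = w\<^sup>4 b\<close> with \<open>b\<close> free of fourth powers. Then \<open>y\<^sup>2 = x\<^sup>3 + b x\<close> is globally
  minimal, so the minimal discriminant is \<open>64 \<bar>b\<bar>\<^sup>3\<close>, and we may work with \<open>\<xi> = x / w\<^sup>2\<close>.
  Here \<open>\<xi>(2P) = (k/s)\<^sup>2\<close>, where no odd prime divides both \<open>k\<close> and \<open>b\<close>. In the next doubling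
  \<open>\<xi>(4P) = ((k\<^sup>4 - b s\<^sup>4) / (2 k s m))\<^sup>2\<close> with \<open>m\<^sup>2 = k\<^sup>4 + b s\<^sup>4\<close>, at most a factor \<open>4\<close> cancels
  inside the square, and after that no doubling causes any cancellation: if \<open>\<xi> = r/t\<close> in lowest
  terms, then \<open>(r\<^sup>2 - b t\<^sup>2)\<^sup>2 / (4 r t (r\<^sup>2 + b t\<^sup>2))\<close> is in lowest terms. The form
  \<open>N = r\<^sup>2 + \<bar>b\<bar> t\<^sup>2\<close> satisfies \<open>N\<^sup>4 \<le> N' \<le> 5 N\<^sup>4\<close> under a doubling, and \<open>ln N / 2\<close> differs from
  the height by a bounded amount. Hence the limit defining the canonical height exists and is at
  least \<open>ln N(4P) / 64\<close>, while \<open>256 N(4P) \<ge> (k\<^sup>4 + \<bar>b\<bar> s\<^sup>4)\<^sup>4 > b\<^sup>4\<close>.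
  That \<open>2\<^sup>n P\<close> is an iterated doubling needs associativity of the group law, which follows from an
  identity between the slopes of the lines involved, valid unless two of the points coincide up
  to sign; the few exceptional configurations are treated separately.\<close>

subsection \<open>The group law of a short Weierstrass equation\<close>

definition short_weierstrass :: "'a::field \<Rightarrow> 'a \<Rightarrow> 'a weierstrass" where
  "short_weierstrass A B = \<lparr>wa1 = 0, wa2 = 0, wa3 = 0, wa4 = A, wa6 = B\<rparr>"

fun neg_point :: "'a::field point \<Rightarrow> 'a point" where
  "neg_point Infinity = Infinity"
| "neg_point (Affine x y) = Affine x (- y)"

lemma neg_neg_point [simp]: "neg_point (neg_point P) = P"
  by (cases P) auto

text \<open>Compares the coefficients in
  \<open>X\<^sup>3 + A X + B - (l X + n)\<^sup>2 = (X - x\<^sub>1) (X - x\<^sub>2) (X - x\<^sub>3)\<close>: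
  the line \<open>y = l x + n\<close> meets the curve in the points over \<open>x\<^sub>1\<close>, \<open>x\<^sub>2\<close>, \<open>x\<^sub>3\<close>,
  counted with multiplicity.\<close>

definition chord :: "'a::field \<Rightarrow> 'a \<Rightarrow> 'a \<Rightarrow> 'a \<Rightarrow> 'a \<Rightarrow> 'a \<Rightarrow> 'a \<Rightarrow> bool" where
  "chord A B l n x1 x2 x3 \<longleftrightarrow>
     x1 + x2 + x3 = l^2 \<and> x1 * x2 + x1 * x3 + x2 * x3 = A - 2 * l * n \<and> x1 * x2 * x3 = n^2 - B"

definition collinear_points :: "'a::field \<Rightarrow> 'a \<Rightarrow> 'a point \<Rightarrow> 'a point \<Rightarrow> 'a point \<Rightarrow> bool" where
  "collinear_points A B P Q R \<longleftrightarrow> (\<exists>l n x1 x2 x3. chord A B l n x1 x2 x3 \<and>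
     P = Affine x1 (l * x1 + n) \<and> Q = Affine x2 (l * x2 + n) \<and> R = Affine x3 (l * x3 + n))"

text \<open>With \<open>L\<^sub>1\<close>, \<open>L\<^sub>2\<close>, \<open>L\<^sub>3\<close> the linear forms of the three given lines, the fourth line
  is \<open>y = (l\<^sub>1 + l\<^sub>2) (x - w) - L\<^sub>3(x)\<close>. Here \<open>p, q, r, u, v, w\<close> are the abscissae
  of \<open>P\<close>, \<open>Q\<close>, \<open>R\<close>, \<open>P + Q\<close>, \<open>(P + Q) + R\<close>, \<open>Q + R\<close>.\<close>

lemma chord_assoc:
  fixes A B :: "'a::field_char_0"
  assumes 1: "chord A B l1 n1 p q u" and 2: "chord A B l2 n2 u r v" and 3: "chord A B l3 n3 q r w"
    and q: "l1 * q + n1 = l3 * q + n3" and r: "l2 * r + n2 = l3 * r + n3"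
    and u: "l2 * u + n2 = - (l1 * u + n1)"
    and K: "w - u = (l3 - l1) * (l3 - l2)"
  defines "l4 \<equiv> l1 + l2 - l3" and "n4 \<equiv> - (l1 + l2) * w - n3"
  shows "chord A B l4 n4 p w v" "l4 * p + n4 = l1 * p + n1" "l4 * w + n4 = - (l3 * w + n3)"
    "l4 * v + n4 = l2 * v + n2"
proof -
  define m1 m2 where "m1 = l1 - l3" and "m2 = l2 - l3"
  have l1: "l1 = l3 + m1" and l2: "l2 = l3 + m2" by (simp_all add: m1_def m2_def)
  have n1: "n1 = n3 - m1 * q" and n2: "n2 = n3 - m2 * r"
    using q r unfolding l1 l2 by (simp_all add: algebra_simps)
  have w: "w = u + m1 * m2" using K unfolding l1 l2 by (simp add: algebra_simps)
  have n3: "2 * n3 = - 2 * l3 * u - m1 * (u - q) - m2 * (u - r)"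
    using u unfolding l1 l2 n1 n2 by (simp add: algebra_simps)
  \<comment> \<open>Subtracting the root sums of \<open>1\<close> and \<open>3\<close>, and below
    those of \<open>2\<close> and \<open>3\<close>, eliminates \<open>p\<close> and
    \<open>v\<close>. Afterwards only the relations \<open>l3\<close> and \<open>n3\<close> are left
    between the parameters, and all claims are polynomial consequences of them.\<close>
  have p: "p = r + m1 * (m1 + m2 + 2 * l3)"
    using 1 3 unfolding chord_def l1 l2 n1 n2 w by algebra
  have v: "v = q + m2 * (m1 + m2 + 2 * l3)"
    using 2 3 unfolding chord_def l1 l2 n1 n2 w by algebra
  have l3: "q + r + w = l3^2" and A: "A = q * r + q * w + r * w + 2 * l3 * n3"
    and B: "B = n3^2 - q * r * w" using 3 unfolding chord_def by (auto simp: algebra_simps)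
  have l4: "l4 = l3 + m1 + m2" unfolding l4_def l1 l2 by simp
  have n4: "n4 = - (2 * l3 + m1 + m2) * w - n3" unfolding n4_def l1 l2 by simp
  show "l4 * w + n4 = - (l3 * w + n3)" unfolding l4 n4 by (simp add: algebra_simps)
  show "l4 * p + n4 = l1 * p + n1" unfolding l4 n4 p l1 n1 w using n3 by algebra
  show "l4 * v + n4 = l2 * v + n2" unfolding l4 n4 v l2 n2 w using n3 by algebra
  have "p + w + v = l4^2" using l3 unfolding p v w l4 by algebra
  moreover have "p * w + p * v + w * v = A - 2 * l4 * n4"
    using l3 n3 unfolding p v w l4 n4 A by algebra
  moreover have "p * w * v = n4^2 - B"
    using l3 n3 unfolding p v w l4 n4 B by algebra
  ultimately show "chord A B l4 n4 p w v" unfolding chord_def by blast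
qed

lemma chord_perm:
  assumes "chord A B l n x1 x2 x3"
  shows "chord A B l n x2 x1 x3" "chord A B l n x1 x3 x2"
  using assms unfolding chord_def by (auto simp: algebra_simps)

lemma chord_uminus: "chord A B l n x1 x2 x3 \<Longrightarrow> chord A B (- l) (- n) x1 x2 x3"
  unfolding chord_def by simp

lemma collinear_points_perm:
  assumes "collinear_points A B P Q R"
  shows "collinear_points A B Q P R" "collinear_points A B P R Q"
  using assms unfolding collinear_points_def by (meson chord_perm)+

lemma collinear_points_neg:
  assumes "collinear_points A B P Q R"
  shows "collinear_points A B (neg_point P) (neg_point Q) (neg_point R)"
proof -
  from assms obtain l n x1 x2 x3 where c: "chord A B l n x1 x2 x3"
     "P = Affine x1 (l * x1 + n)" "Q = Affine x2 (l * x2 + n)" "R = Affine x3 (l * x3 + n)"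
    unfolding collinear_points_def by blast
  show ?thesis unfolding collinear_points_def
    by (rule exI[of _ "-l"], rule exI[of _ "-n"]) (use c chord_uminus in auto)
qed

lemma chord_on_curve:
  fixes A B :: "'a::field_char_0"
  assumes "chord A B l n x1 x2 x3"
  shows "(l * x1 + n)^2 = x1^3 + A * x1 + B"
  using assms unfolding chord_def by algebra

lemma chord_cubic:
  fixes A B :: "'a::field_char_0"
  assumes "chord A B l n x1 x2 x3"
  shows "x^3 + A * x + B - (l * x + n)^2 = (x - x1) * (x - x2) * (x - x3)"
  using assms unfolding chord_def by algebra

section \<open>The addition law read off collinear triples\<close>

locale nonsingular_short =
  fixes A B :: "'a::field_char_0"
  assumes nonsingular: "4 * A^3 + 27 * B^2 \<noteq> 0"
begin

abbreviation E where "E \<equiv> short_weierstrass A B"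
abbreviation add (infixl "\<oplus>" 65) where "add \<equiv> point_add E"
abbreviation coll where "coll \<equiv> collinear_points A B"

lemma on_curve_affine: "on_curve E (Affine x y) \<longleftrightarrow> y^2 = x^3 + A * x + B"
  by (simp add: short_weierstrass_def)

lemma add_affine:
  "Affine x1 y1 \<oplus> Affine x2 y2 =
    (if x1 = x2 \<and> y1 + y2 = 0 then Infinity
     else let l = (if x1 \<noteq> x2 then (y2 - y1) / (x2 - x1) else (3 * x1^2 + A) / (2 * y1));
              x3 = l^2 - x1 - x2
          in Affine x3 (- l * x3 - (y1 - l * x1)))"
  by (simp add: short_weierstrass_def Let_def)

declare point_add.simps(3) [simp del]

lemma add_Infinity [simp]: "P \<oplus> Infinity = P"
  by (cases P) auto

text \<open>Two points with equal abscissae on a line \<open>y = l x + n\<close> are equal, so the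
  case \<open>x1 = x2\<close> is tangency; the branch with value \<open>Infinity\<close> would need
  ordinate zero.\<close>

lemma chord_add:
  assumes c: "chord A B l n x1 x2 x3"
  shows "Affine x1 (l * x1 + n) \<oplus> Affine x2 (l * x2 + n) = Affine x3 (- (l * x3 + n))"
proof (cases "x1 = x2")
  case False
  then have l: "((l * x2 + n) - (l * x1 + n)) / (x2 - x1) = l" by (simp add: field_simps)
  have "l^2 - x1 - x2 = x3" using c unfolding chord_def by algebra
  then show ?thesis using False unfolding add_affine l
    by (simp add: Let_def)
next
  case True
  define y where "y = l * x1 + n"
  \<comment> \<open>With \<open>y = 0\<close> the double root \<open>x1\<close> of
    \<open>X^3 + A X + B - l^2 (X - x1)^2\<close> would be a double root of the cubic itself,
    against nonsingularity.\<close>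
  have "y \<noteq> 0"
  proof
    assume "y = 0"
    then have "n = - l * x1" by (simp add: y_def eq_neg_iff_add_eq_0 add.commute)
    then have "A = - 3 * x1^2" "B = 2 * x1^3" using c True unfolding chord_def by algebra+
    then have "4 * A^3 + 27 * B^2 = 0" by (simp add: power_mult_distrib flip: power_mult)
    with nonsingular show False ..
  qed
  moreover have "3 * x1^2 + A = 2 * y * l" using c True unfolding chord_def y_def by algebra
  ultimately have "(3 * x1^2 + A) / (2 * y) = l" by simp
  moreover have "x3 = l^2 - x1 - x1" using c True unfolding chord_def by algebra
  ultimately have "Affine x1 y \<oplus> Affine x1 y = Affine x3 (- l * x3 - (y - l * x1))"
    using \<open>y \<noteq> 0\<close> unfolding add_affine by (simp add: Let_def)
  then show ?thesis using True by (simp add: y_def)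
qed

lemma coll_add: "coll P Q R \<Longrightarrow> P \<oplus> Q = neg_point R"
  unfolding collinear_points_def using chord_add by auto

lemma coll_on_curve: "coll P Q R \<Longrightarrow> on_curve E P"
  unfolding collinear_points_def using chord_on_curve on_curve_affine by blast

text \<open>The root sum forces the third abscissa to be \<open>l^2 - x1 - x2\<close>; what remains
  is to verify the two other coefficients in \<open>chord\<close>.\<close>

lemma exists_coll:
  assumes P: "on_curve E P" and Q: "on_curve E Q" and "P \<noteq> Infinity" "Q \<noteq> Infinity" "P \<noteq> neg_point Q"
  obtains R where "coll P Q R"
proof -
  obtain x1 y1 x2 y2 where xy: "P = Affine x1 y1" "Q = Affine x2 y2"
    using assms by (metis point.exhaust)
  have c1: "y1^2 = x1^3 + A * x1 + B" and c2: "y2^2 = x2^3 + A * x2 + B"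
    using P Q unfolding xy on_curve_affine by auto
  have ne: "\<not> (x1 = x2 \<and> y1 = - y2)" using assms unfolding xy by auto
  have "\<exists>l n. chord A B l n x1 x2 (l^2 - x1 - x2) \<and> y1 = l * x1 + n \<and> y2 = l * x2 + n"
  proof (cases "x1 = x2")
    case False
    define l n where "l = (y2 - y1) / (x2 - x1)" and "n = y1 - l * x1"
    have y1: "y1 = l * x1 + n" by (simp add: n_def)
    have "l * (x2 - x1) = y2 - y1" using False by (simp add: l_def)
    then have y2: "y2 = l * x2 + n" unfolding n_def by (simp add: algebra_simps)
    \<comment> \<open>The difference of the two curve equations; cancelling \<open>x1 - x2\<close>
      gives the linear coefficient.\<close>
    have "(x1 - x2) * (x1 * x2 + x1 * (l^2 - x1 - x2) + x2 * (l^2 - x1 - x2) - (A - 2 * l * n)) = 0"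
      using c1 c2 unfolding y1 y2 by algebra
    with False have e2: "x1 * x2 + x1 * (l^2 - x1 - x2) + x2 * (l^2 - x1 - x2) = A - 2 * l * n"
      by simp
    have "x1 * x2 * (l^2 - x1 - x2) = n^2 - B"
      using c1 c2 e2 unfolding y1 y2 by algebra
    with e2 y1 y2 show ?thesis unfolding chord_def by fastforce
  next
    case True
    have "(y1 - y2) * (y1 + y2) = 0" using c1 c2 True by algebra
    with ne True have y: "y1 = y2" by (auto simp: add_eq_0_iff)
    with ne True have "2 * y1 \<noteq> 0" by auto
    define l n where "l = (3 * x1^2 + A) / (2 * y1)" and "n = y1 - l * x1"
    have y1: "y1 = l * x1 + n" by (simp add: n_def)
    have "2 * y1 * l = 3 * x1^2 + A" using \<open>2 * y1 \<noteq> 0\<close> by (simp add: l_def)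
    then have "x1 * x1 + x1 * (l^2 - x1 - x1) + x1 * (l^2 - x1 - x1) = A - 2 * l * n"
      "x1 * x1 * (l^2 - x1 - x1) = n^2 - B"
      using c1 unfolding y1 by algebra+
    with y1 y True show ?thesis unfolding chord_def by fastforce
  qed
  then show ?thesis using that unfolding collinear_points_def xy by blast
qed

lemma on_curve_neg [simp]: "on_curve E (neg_point P) \<longleftrightarrow> on_curve E P"
  by (cases P) (simp_all add: on_curve_affine del: on_curve.simps(2))

lemma add_neg_self [simp]: "P \<oplus> neg_point P = Infinity" "neg_point P \<oplus> P = Infinity"
  by (cases P; simp add: add_affine)+

lemma add_eq_Infinity: "P \<oplus> Q = Infinity \<longleftrightarrow> P = neg_point Q"
  by (cases P; cases Q) (auto simp: add_affine Let_def eq_neg_iff_add_eq_0)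

lemma on_curve_add:
  assumes "on_curve E P" "on_curve E Q"
  shows "on_curve E (P \<oplus> Q)"
proof (cases "P = Infinity \<or> Q = Infinity \<or> P = neg_point Q")
  case True
  then show ?thesis using assms by auto
next
  case False
  then obtain R where "coll P Q R" using exists_coll assms by metis
  then show ?thesis using coll_add coll_on_curve collinear_points_perm on_curve_neg by metis
qed

lemma add_comm:
  assumes "on_curve E P" "on_curve E Q"
  shows "P \<oplus> Q = Q \<oplus> P"
proof (cases "P = Infinity \<or> Q = Infinity \<or> P = neg_point Q")
  case True
  then show ?thesis by auto
next
  case False
  then obtain R where "coll P Q R" using exists_coll assms by metis
  then show ?thesis using coll_add collinear_points_perm by metis
qed

lemma neg_add:
  assumes "on_curve E P" "on_curve E Q"
  shows "neg_point (P \<oplus> Q) = neg_point P \<oplus> neg_point Q"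
proof (cases "P = Infinity \<or> Q = Infinity \<or> P = neg_point Q")
  case True
  then show ?thesis by auto
next
  case False
  then obtain R where "coll P Q R" using exists_coll assms by metis
  then show ?thesis using coll_add collinear_points_neg by metis
qed

text \<open>The reflected line carries \<open>-R\<close>, \<open>-Q\<close> and \<open>-P\<close>,
  so \<open>-R = P + Q\<close> and \<open>-Q\<close> add up to \<open>P\<close>. This cancellation
  law stands in for associativity in the degenerate configurations below.\<close>

lemma add_diff_cancel:
  assumes "on_curve E P" "on_curve E Q"
  shows "(P \<oplus> Q) \<oplus> neg_point Q = P"
proof (cases "P = Infinity \<or> Q = Infinity \<or> P = neg_point Q")
  case True
  then show ?thesis by auto
next
  case False
  then obtain R where "coll P Q R" using exists_coll assms by metis
  then show ?thesis
    using coll_add collinear_points_perm collinear_points_neg neg_neg_point by metis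
qed

section \<open>Associativity\<close>

lemma collE:
  assumes "coll P Q R"
  obtains l n x1 x2 x3 where "chord A B l n x1 x2 x3"
     "P = Affine x1 (l * x1 + n)" "Q = Affine x2 (l * x2 + n)" "R = Affine x3 (l * x3 + n)"
  using assms unfolding collinear_points_def by blast

text \<open>The slope identity required by \<open>chord_assoc\<close> comes from evaluating the
  cubic of the third line at \<open>u\<close>: there \<open>(l1 u + n1)^2 - (l3 u + n3)^2\<close>
  splits into \<open>(l1 - l3) (u - q)\<close> and \<open>(l3 - l2) (u - r)\<close>. Cancelling
  \<open>u - q\<close> and \<open>u - r\<close> is the reason why \<open>U\<close> must differ from
  \<open>Q\<close> and \<open>R\<close> up to sign.\<close>

lemma coll_assoc:
  assumes "coll P Q U" "coll (neg_point U) R V" "coll Q R W"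
    and UQ: "U \<noteq> Q" "U \<noteq> neg_point Q" and UR: "U \<noteq> R" "U \<noteq> neg_point R"
  shows "coll P (neg_point W) V"
proof -
  obtain l1 n1 p q u where c1: "chord A B l1 n1 p q u"
    and P: "P = Affine p (l1 * p + n1)" "Q = Affine q (l1 * q + n1)" "U = Affine u (l1 * u + n1)"
    using assms(1) by (rule collE)
  obtain l2 n2 r v u' where c2: "chord A B l2 n2 u' r v"
    and P2: "neg_point U = Affine u' (l2 * u' + n2)" "R = Affine r (l2 * r + n2)" 
      "V = Affine v (l2 * v + n2)"
    using assms(2) by (rule collE)
  obtain l3 n3 q' r' w where c3: "chord A B l3 n3 q' r' w"
    and P3: "Q = Affine q' (l3 * q' + n3)" "R = Affine r' (l3 * r' + n3)"
      "W = Affine w (l3 * w + n3)"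
    using assms(3) by (rule collE)
  have eq: "u' = u" "q' = q" "r' = r" and q: "l1 * q + n1 = l3 * q + n3"
    and r: "l2 * r + n2 = l3 * r + n3" and u: "l2 * u + n2 = - (l1 * u + n1)"
    using P P2 P3 by auto
  have yU: "(l1 * u + n1)^2 = u^3 + A * u + B"
    and yQ: "(l1 * q + n1)^2 = q^3 + A * q + B"
    and yR: "(l2 * r + n2)^2 = r^3 + A * r + B"
    using chord_on_curve c1 c2 chord_perm by metis+
  have "u \<noteq> q"
  proof
    assume "u = q"
    with yU yQ UQ show False unfolding P by (auto simp: power2_eq_iff)
  qed
  moreover have "u \<noteq> r"
  proof
    assume "u = r"
    with yU yR u have "(l1 * u + n1)^2 = (l2 * r + n2)^2" by simp
    with UR \<open>u = r\<close> show False unfolding P P2 by (auto simp: power2_eq_iff)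
  qed
  moreover have "(u - q) * (u - r) * ((w - u) - (l3 - l1) * (l3 - l2)) = 0"
    using chord_cubic[OF c3[unfolded eq], of u] yU q r u by algebra
  ultimately have "w - u = (l3 - l1) * (l3 - l2)" by simp
  note a = chord_assoc[OF c1 c2[unfolded eq] c3[unfolded eq] q r u this]
  show ?thesis unfolding collinear_points_def P P2 P3 eq
    by (rule exI, rule exI, rule exI[of _ p], rule exI[of _ w], rule exI[of _ v]) (use a in auto)
qed


text \<open>Associativity for \<open>P + Q = R\<close> and \<open>Q + R = P\<close> (so that \<open>2 Q = O\<close>), when \<open>coll_assoc\<close>
  applies neither to \<open>P, Q, R\<close> nor to \<open>R, Q, P\<close>.\<close>

lemma double_add_two_torsion:
  assumes P: "on_curve E P" and Q: "on_curve E Q" and Q2: "Q = neg_point Q" and "Q \<noteq> Infinity"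
  shows "(P \<oplus> Q) \<oplus> (P \<oplus> Q) = P \<oplus> P"
proof (cases "P = Infinity \<or> P = neg_point Q")
  case True
  then show ?thesis using Q2 by (metis add_neg_self(1) point_add.simps(1))
next
  case False
  then obtain U where U: "coll P Q U" using exists_coll assms by metis
  define R where "R = P \<oplus> Q"
  have RU: "R = neg_point U" using coll_add[OF U] by (simp add: R_def)
  have cR: "on_curve E R" using on_curve_add P Q by (simp add: R_def)
  have PR: "P = R \<oplus> Q" using add_diff_cancel[OF P Q] Q2 by (simp add: R_def)
  show ?thesis
  proof (cases "R = neg_point R")
    case True
    then have "P \<oplus> P = Infinity" 
      using neg_add[OF P Q] neg_add[OF cR Q] Q2 PR by (metis add_neg_self(1))
    then show ?thesis using True by (metis R_def add_neg_self(1))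
  next
    case False
    have "R \<noteq> Infinity" using False by auto
    then obtain V where V: "coll R R V" using exists_coll cR False by metis
    obtain l1 n1 p e u where c1: "chord A B l1 n1 p e u"
      and P1: "P = Affine p (l1 * p + n1)" "Q = Affine e (l1 * e + n1)" "U = Affine u (l1 * u + n1)"
      using U by (rule collE)
    obtain l2 n2 r r' v where c2: "chord A B l2 n2 r r' v"
      and P2: "R = Affine r (l2 * r + n2)" "R = Affine r' (l2 * r' + n2)" "V = Affine v (l2 * v + n2)"
      using V by (rule collE)
    have eq: "r = u" "r' = u" and r: "l2 * u + n2 = - (l1 * u + n1)" using P1 P2 RU by auto
    have "l1 * e + n1 = - (l1 * e + n1)" using P1 Q2 by simp
    then have "2 * (l1 * e + n1) = 0" by algebra
    then have e: "l1 * e + n1 = 0" by (simp only: mult_eq_0_iff) simp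
    have ue: "l1 * u + n1 \<noteq> 0"
    proof
      assume "l1 * u + n1 = 0"
      then have "R = Affine u 0" using P2(1) r unfolding eq by simp
      with False show False by simp
    qed
    \<comment> \<open>Here \<open>r = u\<close>, so the cancellation in \<open>coll_assoc\<close>
      breaks down. The third line is the reflection of the first, through \<open>Q = -Q\<close>,
      \<open>R = -U\<close> and \<open>-P\<close>; the slope identity now follows from the tangency
      of the second line at \<open>R\<close>, after division by the ordinate of
      \<open>U\<close>.\<close>
    have c3: "chord A B (- l1) (- n1) e u p"
      using c1 unfolding chord_def by (auto simp: algebra_simps)
    have r3: "l2 * u + n2 = - l1 * u + - n1" using r by simp
    have "(l1 * u + n1) * ((p - u) - (- l1 - l1) * (- l1 - l2)) = 0"
      using c1 c2 r e unfolding eq chord_def by algebra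
    then have K: "p - u = (- l1 - l1) * (- l1 - l2)"
      using ue by (simp only: mult_eq_0_iff right_minus_eq simp_thms)
    have e3: "l1 * e + n1 = - l1 * e + - n1" using e by algebra
    note a = chord_assoc[OF c1 c2[unfolded eq] c3 e3 r3 r K]
    have "coll P P V"
      unfolding collinear_points_def P1 P2 eq
      by (rule exI, rule exI, rule exI[of _ p], rule exI[of _ p], rule exI[of _ v]) (use a in auto)
    then show ?thesis using V coll_add by (metis R_def)
  qed
qed

text \<open>Of the four coincidences excluded in \<open>coll_assoc\<close>,
  \<open>U = neg_point Q\<close> would force \<open>P = Infinity\<close>, and \<open>U = R\<close>
  means \<open>P + Q = -R\<close>, which is settled directly. The other two are the exclusions
  \<open>ne\<close>.\<close>

lemma add_assoc_generic:
  assumes P: "on_curve E P" and Q: "on_curve E Q" and R: "on_curve E R"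
    and ne: "P \<oplus> Q \<noteq> neg_point Q" "P \<oplus> Q \<noteq> R"
  shows "(P \<oplus> Q) \<oplus> R = P \<oplus> (Q \<oplus> R)"
proof -
  consider "P = Infinity \<or> Q = Infinity \<or> R = Infinity" | "P = neg_point Q" | "Q = neg_point R"
    | "P \<oplus> Q = neg_point R" | "P \<noteq> Infinity" "Q \<noteq> Infinity" "R \<noteq> Infinity" "P \<noteq> neg_point Q"
      "Q \<noteq> neg_point R" "P \<oplus> Q \<noteq> neg_point R" by blast
  then show ?thesis
  proof cases
    case 1
    then show ?thesis by auto
  next
    case 2
    have "neg_point Q \<oplus> (Q \<oplus> R) = R"
      using add_diff_cancel[OF R Q] add_comm Q R on_curve_add on_curve_neg by metis
    with 2 show ?thesis by simp
  next
    case 3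
    then show ?thesis using add_diff_cancel[OF P Q] by simp
  next
    case 4
    then have "P = neg_point R \<oplus> neg_point Q" using add_diff_cancel[OF P Q] by simp
    then have "P = neg_point (Q \<oplus> R)" using neg_add[OF Q R] add_comm Q R on_curve_neg by metis
    with 4 show ?thesis by simp
  next
    case 5
    obtain U where U: "coll P Q U" using exists_coll[OF P Q] 5 by metis
    obtain W where W: "coll Q R W" using exists_coll[OF Q R] 5 by metis
    have PQ: "P \<oplus> Q = neg_point U" and QR: "Q \<oplus> R = neg_point W" using U W coll_add by auto
    have "neg_point U \<noteq> Infinity" using PQ 5 add_eq_Infinity by metis
    moreover have "on_curve E (neg_point U)" using PQ on_curve_add P Q by metis
    ultimately obtain V where V: "coll (neg_point U) R V" using exists_coll 5 R PQ by metis
    have "U \<noteq> neg_point Q"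
    proof
      assume "U = neg_point Q"
      then have "P \<oplus> Q = Q" using PQ by simp
      then have "P = Infinity" using add_diff_cancel[OF P Q] by simp
      with 5 show False by simp
    qed
    moreover have "U \<noteq> Q" "U \<noteq> R" "U \<noteq> neg_point R" using ne 5 PQ by auto
    ultimately have "coll P (neg_point W) V" using coll_assoc[OF U V W] by blast
    then show ?thesis using V coll_add PQ QR by metis
  qed
qed

text \<open>Commutativity exchanges the roles of \<open>P\<close> and \<open>R\<close>, which moves
  the exclusions to \<open>Q \<oplus> R\<close>.\<close>

lemma add_assoc_generic':
  assumes P: "on_curve E P" and Q: "on_curve E Q" and R: "on_curve E R"
    and ne: "Q \<oplus> R \<noteq> neg_point Q" "Q \<oplus> R \<noteq> P"
  shows "(P \<oplus> Q) \<oplus> R = P \<oplus> (Q \<oplus> R)"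
proof -
  have "(R \<oplus> Q) \<oplus> P = R \<oplus> (Q \<oplus> P)"
    using add_assoc_generic[OF R Q P] ne add_comm[OF R Q] by simp
  then show ?thesis using add_comm P Q R on_curve_add by metis
qed

text \<open>Associativity at \<open>Q\<close>, \<open>Q\<close>, \<open>2Q\<close>. The generic
  version can fail only if \<open>3Q = -Q\<close> or \<open>3Q = Q\<close>, and then both sides are
  \<open>Infinity\<close>. It settles the exceptional case \<open>P = -2Q\<close>,
  \<open>R = -3Q\<close> of \<open>add_assoc\<close>.\<close>

lemma quadruple:
  assumes Q: "on_curve E Q"
  shows "Q \<oplus> (Q \<oplus> (Q \<oplus> Q)) = (Q \<oplus> Q) \<oplus> (Q \<oplus> Q)"
proof -
  let ?T = "Q \<oplus> Q"
  have T: "on_curve E ?T" using Q on_curve_add by blast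
  consider "Q = Infinity" | "Q \<oplus> ?T = neg_point Q" | "Q \<oplus> ?T = Q"
    | "Q \<oplus> ?T \<noteq> neg_point Q" "Q \<oplus> ?T \<noteq> Q" by blast
  then show ?thesis
  proof cases
    case 1
    then show ?thesis by simp
  next
    case 2
    have "?T = neg_point Q \<oplus> neg_point Q"
      using add_diff_cancel[OF T Q] 2 add_comm Q T by metis
    then have "?T = neg_point ?T" using neg_add[OF Q Q] by simp
    then show ?thesis using 2 by (metis add_neg_self(1))
  next
    case 3
    then have "?T = Infinity" using add_diff_cancel[OF T Q] add_comm[OF Q T] by simp
    then show ?thesis by simp
  next
    case 4
    then show ?thesis using add_assoc_generic'[OF Q Q T] by simp
  qed
qed

text \<open>Each generic version has two exceptions; cases 3 to 6 are the four ways in which both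
  fail at once.\<close>

theorem add_assoc:
  assumes P: "on_curve E P" and Q: "on_curve E Q" and R: "on_curve E R"
  shows "(P \<oplus> Q) \<oplus> R = P \<oplus> (Q \<oplus> R)"
proof -
  have aux: "(P \<oplus> Q) \<oplus> R = P \<oplus> (Q \<oplus> R)"
    if P: "on_curve E P" and Q: "on_curve E Q" and R: "on_curve E R"
    and PQ: "P \<oplus> Q = neg_point Q" and QR: "Q \<oplus> R = P" for P Q R
  proof -
    let ?N = "neg_point Q"
    have N: "on_curve E ?N" using Q by simp
    \<comment> \<open>With \<open>N = -Q\<close> the point \<open>P\<close> is \<open>2N\<close> and
      \<open>R\<close> is \<open>3N\<close>, so the claim is \<open>quadruple\<close> for
      \<open>N\<close>.\<close>
    have Pe: "P = ?N \<oplus> ?N" using add_diff_cancel[OF P Q] PQ by simp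
    have Re: "R = P \<oplus> ?N" using add_diff_cancel[OF R Q] QR add_comm[OF Q R] by simp
    show ?thesis using quadruple[OF N] PQ QR Pe Re add_comm[OF P N] by metis
  qed
  consider "P \<oplus> Q \<noteq> neg_point Q" "P \<oplus> Q \<noteq> R" | "Q \<oplus> R \<noteq> neg_point Q" "Q \<oplus> R \<noteq> P"
    | "P \<oplus> Q = neg_point Q" "Q \<oplus> R = neg_point Q" | "P \<oplus> Q = neg_point Q" "Q \<oplus> R = P"
    | "Q \<oplus> R = neg_point Q" "P \<oplus> Q = R" | "P \<oplus> Q = R" "Q \<oplus> R = P" by blast
  then show ?thesis
  proof cases
    case 1
    then show ?thesis by (rule add_assoc_generic[OF P Q R])
  next
    case 2
    then show ?thesis by (rule add_assoc_generic'[OF P Q R])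
  next
    case 3
    then have "P = R" using add_diff_cancel P Q R add_comm by metis
    then show ?thesis using add_comm P Q on_curve_add by metis
  next
    case 4
    then show ?thesis by (rule aux[OF P Q R])
  next
    case 5
    then have "(R \<oplus> Q) \<oplus> P = R \<oplus> (Q \<oplus> P)"
      using aux[OF R Q P] add_comm[OF R Q] add_comm[OF P Q] by simp
    then show ?thesis using add_comm P Q R on_curve_add by metis
  next
    case 6
    \<comment> \<open>\<open>P + Q = R = P - Q\<close> makes \<open>Q\<close> its own negative, and
      the claim becomes \<open>2 (P + Q) = 2 P\<close>.\<close>
    have "P \<oplus> neg_point Q = R" "R \<oplus> neg_point Q = P"
      using 6 add_diff_cancel add_comm P Q R by metis+
    then have "neg_point Q = Q"
      using 6 add_diff_cancel[of Q P] add_diff_cancel[of "neg_point Q" P] add_comm P Q R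
      by (metis on_curve_neg)
    then show ?thesis using 6 double_add_two_torsion[OF P Q] by (cases "Q = Infinity") auto
  qed
qed

lemma on_curve_mult: "on_curve E P \<Longrightarrow> on_curve E (point_mult E n P)"
  by (induction n) (simp_all add: on_curve_add)

lemma mult_add:
  assumes "on_curve E P"
  shows "point_mult E (m + n) P = point_mult E m P \<oplus> point_mult E n P"
  by (induction m) (simp_all add: add_assoc on_curve_mult assms)

lemma mult_double:
  "on_curve E P \<Longrightarrow> point_mult E (2 * n) P = point_mult E n P \<oplus> point_mult E n P"
  by (metis mult_2 mult_add)

end

subsection \<open>The minimal discriminant of \<open>y\<^sup>2 = x\<^sup>3 + a x\<close>\<close>

lemma quotient_ofE:
  obtains m n :: int where "quotient_of q = (m, n)" "q = of_int m / of_int n" "n > 0" "coprime m n"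
  by (metis old.prod.exhaust quotient_of_coprime quotient_of_denom_pos quotient_of_div)

lemma of_int_fract_eq_iff:
  assumes "n \<noteq> 0" "d \<noteq> 0"
  shows "(of_int m / of_int n :: rat) = of_int c / of_int d \<longleftrightarrow> m * d = c * n"
proof -
  have "(of_int m / of_int n :: rat) = of_int c / of_int d \<longleftrightarrow>
      (of_int m * of_int d :: rat) = of_int c * of_int n"
    using assms by (simp add: frac_eq_eq)
  then show ?thesis by (simp flip: of_int_mult)
qed

section \<open>Integrality and valuation of rationals at a prime\<close>

lemma padic_integral_iff:
  assumes "prime p"
  shows "padic_integral p q \<longleftrightarrow> (\<exists>m n. \<not> int p dvd n \<and> q = of_int m / of_int n)"
proof
  show "padic_integral p q \<Longrightarrow> \<exists>m n. \<not> int p dvd n \<and> q = of_int m / of_int n"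
    unfolding padic_integral_def by (rule quotient_ofE[of q]) auto
next
  assume "\<exists>m n. \<not> int p dvd n \<and> q = of_int m / of_int n"
  then obtain m n where n: "\<not> int p dvd n" and q: "q = of_int m / of_int n" by blast
  obtain c d where cd: "quotient_of q = (c, d)" "q = of_int c / of_int d" "d > 0" "coprime c d"
    by (rule quotient_ofE)
  have "m * d = c * n" using q cd n by (subst (asm) cd(2)) (subst (asm) of_int_fract_eq_iff, auto)
  then have "d dvd n"
    using cd(4) by (metis coprime_commute coprime_dvd_mult_right_iff dvd_triv_right)
  then show "padic_integral p q" unfolding padic_integral_def cd(1) using n by auto
qed

lemma padic_integral_of_int: "padic_integral p (of_int m)" if "prime p"
  using that not_prime_1 unfolding padic_integral_iff[OF that]
  by (intro exI[of _ m] exI[of _ 1]) auto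

lemma padic_integral_mult:
  assumes "prime p" "padic_integral p x" "padic_integral p y"
  shows "padic_integral p (x * y)"
proof -
  obtain m n where x: "\<not> int p dvd n" "x = of_int m / of_int n"
    using assms padic_integral_iff by blast
  obtain c d where y: "\<not> int p dvd d" "y = of_int c / of_int d"
    using assms padic_integral_iff by blast
  show ?thesis unfolding padic_integral_iff[OF assms(1)] using x y assms(1)
    by (intro exI[of _ "m * c"] exI[of _ "n * d"]) (auto simp: prime_dvd_mult_iff)
qed

lemma padic_integral_add:
  assumes "prime p" "padic_integral p x" "padic_integral p y"
  shows "padic_integral p (x + y)"
proof -
  obtain m n where x: "\<not> int p dvd n" "x = of_int m / of_int n"
    using assms padic_integral_iff by blast
  obtain c d where y: "\<not> int p dvd d" "y = of_int c / of_int d"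
    using assms padic_integral_iff by blast
  have "n \<noteq> 0" "d \<noteq> 0" using x y by auto
  then show ?thesis unfolding padic_integral_iff[OF assms(1)] using x y assms(1)
    by (intro exI[of _ "m * d + c * n"] exI[of _ "n * d"])
       (auto simp: prime_dvd_mult_iff field_simps)
qed

lemma padic_integral_power:
  "prime p \<Longrightarrow> padic_integral p x \<Longrightarrow> padic_integral p (x ^ k)"
  using padic_integral_of_int[of p 1] by (induction k) (auto intro: padic_integral_mult)

lemma padic_integral_numeral:
  "prime p \<Longrightarrow> padic_integral p (numeral k)" "prime p \<Longrightarrow> padic_integral p (- numeral k)"
  using padic_integral_of_int[of p "numeral k"] padic_integral_of_int[of p "- numeral k"] by auto

lemma padic_integral_diff:
  "prime p \<Longrightarrow> padic_integral p x \<Longrightarrow> padic_integral p y \<Longrightarrow> padic_integral p (x - y)"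
  using padic_integral_add[of p x "- 1 * y"] padic_integral_mult[of p "-1" y]
    padic_integral_of_int[of p "-1"] by simp

lemmas padic_integral_intros = padic_integral_add padic_integral_diff padic_integral_mult
  padic_integral_power padic_integral_numeral

text \<open>Euclid's lemma in the ring of rationals integral at \<open>p\<close>: if
  \<open>p\<close> divides a power, it divides the base.\<close>

lemma padic_integral_divide_prime:
  assumes p: "prime p" and "padic_integral p x" "padic_integral p (x ^ k / of_nat p)"
  shows "padic_integral p (x / of_nat p)"
proof -
  obtain m n where x: "\<not> int p dvd n" "x = of_int m / of_int n"
    using assms padic_integral_iff by blast
  obtain c d where y: "\<not> int p dvd d" "x ^ k / of_nat p = of_int c / of_int d"
    using assms padic_integral_iff by blast
  have p0: "p \<noteq> 0" and pp: "prime (int p)" using p by auto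
  have "of_int (m ^ k) / of_int (n ^ k * int p) = (of_int c / of_int d :: rat)"
    using y(2) unfolding x(2) by (simp add: power_divide)
  then have "m ^ k * d = c * (n ^ k * int p)"
    using x(1) y(1) p0 by (subst (asm) of_int_fract_eq_iff) auto
  then have "int p dvd m ^ k * d" by auto
  then have "int p dvd m" using pp y(1) by (meson prime_dvd_mult_iff prime_dvd_power)
  then obtain m' where "m = int p * m'" by auto
  then have "x / of_nat p = of_int m' / of_int n" using x(2) p0 by simp
  then show ?thesis using x(1) padic_integral_iff[OF p] by blast
qed

text \<open>A factor \<open>p\<close> in the denominator of \<open>x\<close> puts \<open>p^k\<close>
  into that of \<open>x^k\<close>, and \<open>c\<close> is not divisible enough to cancel
  it.\<close>

lemma padic_integral_power_cancel:
  assumes p: "prime p" and c: "\<not> int p ^ k dvd c" and i: "padic_integral p (of_int c * x ^ k)"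
  shows "padic_integral p x"
proof (rule ccontr)
  assume *: "\<not> padic_integral p x"
  obtain m n where mn: "quotient_of x = (m, n)" "x = of_int m / of_int n" "n > 0" "coprime m n"
    by (rule quotient_ofE)
  have pn: "int p dvd n" using * mn(1) by (simp add: padic_integral_def)
  then have pm: "coprime (int p) m" using mn(4)
    by (metis coprime_commute coprime_divisors dvd_refl)
  obtain e d where y: "\<not> int p dvd d" "of_int c * x ^ k = of_int e / of_int d"
    using i padic_integral_iff[OF p] by blast
  have "of_int (c * m ^ k) / of_int (n ^ k) = (of_int e / of_int d :: rat)"
    using y(2) unfolding mn(2) by (simp add: power_divide)
  then have "c * m ^ k * d = e * n ^ k"
    using mn(3) y(1) by (subst (asm) of_int_fract_eq_iff) auto
  then have "int p ^ k dvd c * (m ^ k * d)"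
    using pn by (metis dvd_mult dvd_power_same mult.assoc)
  moreover have "coprime (int p ^ k) (m ^ k * d)"
    using pm y(1) p by (auto intro!: coprime_power_left_iff[THEN iffD2] prime_imp_coprime)
  ultimately have "int p ^ k dvd c" using coprime_dvd_mult_left_iff by blast
  with c show False ..
qed

lemma padic_val_fract:
  assumes p: "prime p" and "m \<noteq> 0" "n \<noteq> 0"
  shows "padic_val p (of_int m / of_int n) = int (multiplicity (int p) m) - int (multiplicity (int p) n)"
proof -
  obtain c d where cd: "quotient_of (of_int m / of_int n) = (c, d)"
     "(of_int m / of_int n :: rat) = of_int c / of_int d" "d > 0" "coprime c d"
    by (rule quotient_ofE)
  have eq: "m * d = c * n" using cd(2,3) assms by (simp add: of_int_fract_eq_iff)
  then have "c \<noteq> 0" using assms cd(3) by auto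
  have pe: "prime_elem (int p)" using p by auto
  have "multiplicity (int p) m + multiplicity (int p) d = multiplicity (int p) c + multiplicity (int p) n"
    using prime_elem_multiplicity_mult_distrib[OF pe, of m d]
      prime_elem_multiplicity_mult_distrib[OF pe, of c n] eq assms cd(3) \<open>c \<noteq> 0\<close> by simp
  then show ?thesis unfolding padic_val_def cd(1) by simp
qed

lemma padic_val_mult:
  assumes p: "prime p" and "x \<noteq> 0" "y \<noteq> 0"
  shows "padic_val p (x * y) = padic_val p x + padic_val p y"
proof -
  obtain m n where x: "x = of_int m / of_int n" "n > 0" by (rule quotient_ofE)
  obtain c d where y: "y = of_int c / of_int d" "d > 0" by (rule quotient_ofE)
  have nz: "m \<noteq> 0" "n \<noteq> 0" "c \<noteq> 0" "d \<noteq> 0" using x y assms by auto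
  have pe: "prime_elem (int p)" using p by auto
  have "x * y = of_int (m * c) / of_int (n * d)" using x y by simp
  then show ?thesis unfolding x(1) y(1) using nz
    by (simp only: padic_val_fract[OF p] mult_eq_0_iff simp_thms
      prime_elem_multiplicity_mult_distrib[OF pe])
qed

lemma padic_val_power:
  assumes p: "prime p" and "x \<noteq> 0"
  shows "padic_val p (x ^ k) = int k * padic_val p x"
  by (induction k) (use assms padic_val_fract[OF p, of 1 1] in \<open>simp_all add: padic_val_mult algebra_simps\<close>)

lemma padic_val_nonneg:
  assumes "padic_integral p x"
  shows "padic_val p x \<ge> 0"
  using assms unfolding padic_integral_def padic_val_def by (simp add: not_dvd_imp_multiplicity_0)

section \<open>Invariants of the models of \<open>y^2 = x^3 + a x\<close>\<close>

lemma b_change_vars_curve_E: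
  fixes a :: int and u r s t :: rat
  assumes "u \<noteq> 0"
  defines "M \<equiv> change_vars u r s t (curve_E a)"
  shows "wb2 M = 12 * r / u^2" "wb4 M = (2 * of_int a + 6 * r^2) / u^4"
    "wb6 M = 4 * (r * of_int a + r^3) / u^6"
    "wb8 M = (3 * r^4 + 6 * of_int a * r^2 - of_int a^2) / u^8"
proof -
  \<comment> \<open>Powers of \<open>v\<close> in place of denominators turn the claims into
    polynomial identities. \<open>s\<close> and \<open>t\<close> drop out, since the b-invariants
    belong to the equation after completing the square in \<open>y\<close>.\<close>
  define v where "v = inverse u"
  have d: "x / u ^ k = x * v ^ k" for x k by (simp add: v_def field_simps)
  have d1: "x / u = x * v" for x by (simp add: v_def field_simps)
  note defs = M_def change_vars_def curve_E_def wb2_def wb4_def wb6_def wb8_def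
  show "wb2 M = 12 * r / u^2" unfolding defs weierstrass.simps d d1 by algebra
  show "wb4 M = (2 * of_int a + 6 * r^2) / u^4" unfolding defs weierstrass.simps d d1 by algebra
  show "wb6 M = 4 * (r * of_int a + r^3) / u^6" unfolding defs weierstrass.simps d d1 by algebra
  show "wb8 M = (3 * r^4 + 6 * of_int a * r^2 - of_int a^2) / u^8"
    unfolding defs weierstrass.simps d d1 by algebra
qed

lemma discriminant_change_vars_curve_E:
  assumes "u \<noteq> 0"
  shows "discriminant (change_vars u r s t (curve_E a)) = - 64 * (of_int a / u^4) ^ 3"
proof -
  define v where "v = inverse u"
  have d: "x / u ^ k = x * v ^ k" for x k by (simp add: v_def field_simps)
  show ?thesis unfolding discriminant_def b_change_vars_curve_E[OF assms] d by algebra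
qed

lemma padic_integral_wb:
  assumes "prime p" "\<forall>c\<in>wcoeffs M. padic_integral p c"
  shows "padic_integral p (wb2 M)" "padic_integral p (wb4 M)" "padic_integral p (wb6 M)"
    "padic_integral p (wb8 M)"
  using assms unfolding wb2_def wb4_def wb6_def wb8_def wcoeffs_def
  by (auto intro!: padic_integral_intros)

text \<open>At the prime 2 the discriminant does not suffice: since \<open>c\<^sub>6 = 0\<close>, the coefficient
  \<open>b\<^sub>2\<close> is even, which forces \<open>16\<close> to divide \<open>c\<^sub>4 = -48 a / u\<^sup>4\<close>.\<close>

lemma padic_integral_a4_quotient:
  assumes p: "prime p" and u: "u \<noteq> 0"
    and M: "\<forall>c\<in>wcoeffs (change_vars u r s t (curve_E a)). padic_integral p c"
  shows "padic_integral p (of_int a / u^4)"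
proof (cases "p = 2")
  case False
  let ?M = "change_vars u r s t (curve_E a)"
  \<comment> \<open>For odd \<open>p\<close> the discriminant suffices: its factor 64 is a power of
    2, so \<open>p^3\<close> does not divide it.\<close>
  have "padic_integral p (- 64 * (of_int a / u^4) ^ 3)"
    unfolding discriminant_change_vars_curve_E[OF u, symmetric, of a r s t] discriminant_def
    by (intro padic_integral_intros padic_integral_wb[OF p M] p)
       (use padic_integral_diff[OF p padic_integral_of_int[OF p, of 0] padic_integral_power[OF p padic_integral_wb(1)[OF p M], of 2]] in simp)
  moreover have "\<not> int p ^ 3 dvd - 64"
  proof
    assume "int p ^ 3 dvd - 64"
    then have "int p dvd - 64" by (rule dvd_trans[rotated]) simp
    then have "int p dvd 2 ^ 6" by simp
    then have "int p dvd 2" using prime_dvd_power[of "int p" 2 6] p by simp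
    then have "int p dvd int 2" by simp
    then have "p dvd 2" by (simp only: int_dvd_int_iff)
    then show False using p False by (simp add: primes_dvd_imp_eq)
  qed
  ultimately show ?thesis
    using padic_integral_power_cancel[OF p, of 3 "-64" "of_int a / u^4"] by simp
next
  case True
  let ?M = "change_vars u r s t (curve_E a)"
  note p2 = p[unfolded True]
  have i: "padic_integral 2 (wa1 ?M)" "padic_integral 2 (wa2 ?M)" "padic_integral 2 (wa3 ?M)" 
    "padic_integral 2 (wa4 ?M)" using M True by (auto simp: wcoeffs_def)
  note b = padic_integral_wb[OF p2 M[unfolded True]]
  \<comment> \<open>Half of the equation \<open>c6 = 0\<close>, where
    \<open>c6 = - b2^3 + 36 b2 b4 - 216 b6\<close>.\<close>
  have "wb2 ?M ^ 3 / 2 = 18 * wb2 ?M * wb4 ?M - 108 * wb6 ?M"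
  proof -
    define v where "v = inverse u"
    have d: "x / u ^ k = x * v ^ k" for x k by (simp add: v_def field_simps)
    have "wb2 ?M ^ 3 = 2 * (18 * wb2 ?M * wb4 ?M - 108 * wb6 ?M)"
      unfolding b_change_vars_curve_E[OF u] d by algebra
    then show ?thesis by simp
  qed
  moreover have "padic_integral 2 (18 * wb2 ?M * wb4 ?M - 108 * wb6 ?M)"
    using b p2 by (auto intro!: padic_integral_intros)
  ultimately have "padic_integral 2 (wb2 ?M ^ 3 / 2)" by (simp only:)
  then have "padic_integral 2 (wb2 ?M / 2)"
    using padic_integral_divide_prime[OF p2 b(1), of 3] by simp
  \<comment> \<open>This difference is \<open>a1^2 / 2\<close>, so \<open>a1\<close> is even at
    2.\<close>
  then have "padic_integral 2 (wb2 ?M / 2 - 2 * wa2 ?M)"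
    using i p2 by (auto intro!: padic_integral_intros)
  then have "padic_integral 2 (wa1 ?M ^ 2 / 2)"
    by (simp add: wb2_def add_divide_distrib)
  then have h: "padic_integral 2 (wa1 ?M / 2)"
    using padic_integral_divide_prime[OF p2 i(1), of 2] by simp
  \<comment> \<open>\<open>c4 = b2^2 - 24 b4 = - 48 a / u^4\<close>, divided by 16. Since
    \<open>b2 = 4 ((a1/2)^2 + a2)\<close> and \<open>b4 = 2 (a4 + (a1/2) a3)\<close> with brackets
    integral at 2, the quotient is integral at 2.\<close>
  have "- 3 * (of_int a / u^4) = (wb2 ?M ^ 2 - 24 * wb4 ?M) / 16"
  proof -
    define v where "v = inverse u"
    have d: "x / u ^ k = x * v ^ k" for x k by (simp add: v_def field_simps)
    have "- 48 * (of_int a / u^4) = wb2 ?M ^ 2 - 24 * wb4 ?M"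
      unfolding b_change_vars_curve_E[OF u] d by algebra
    then show ?thesis by simp
  qed
  also have "\<dots> = ((wa1 ?M / 2) ^ 2 + wa2 ?M) ^ 2 - 3 * (wa4 ?M + wa1 ?M / 2 * wa3 ?M)"
    by (simp add: wb2_def wb4_def field_simps power2_eq_square)
  finally have "- 3 * (of_int a / u^4) =
    ((wa1 ?M / 2) ^ 2 + wa2 ?M) ^ 2 - 3 * (wa4 ?M + wa1 ?M / 2 * wa3 ?M)" .
  moreover have "padic_integral 2 (((wa1 ?M / 2) ^ 2 + wa2 ?M) ^ 2 - 3 * (wa4 ?M + wa1 ?M / 2 * wa3 ?M))"
    by (intro padic_integral_intros i h p2)
  ultimately have "padic_integral 2 (- 3 * (of_int a / u^4))" by (simp only:)
  then show ?thesis
    using padic_integral_power_cancel[OF p2, of 1 "-3" "of_int a / u^4"] True by simp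
qed

text \<open>For a model integral at \<open>p\<close>, \<open>b (w/u)^4\<close> is integral at
  \<open>p\<close>, hence so is \<open>w/u\<close>, because \<open>p^4\<close> does not divide
  \<open>b\<close>. The discriminant of the model is that of \<open>curve_E b\<close> times
  \<open>(w/u)^12\<close>, so its valuation is no smaller.\<close>

lemma minimal_discriminant_curve_E:
  assumes a: "a = w ^ 4 * b" and "w \<noteq> 0" "b \<noteq> 0"
    and free: "\<And>p. prime p \<Longrightarrow> \<not> int p ^ 4 dvd b"
  shows "minimal_discriminant (curve_E a) = nat (64 * \<bar>b\<bar> ^ 3)"
proof -
  let ?W = "curve_E a" and ?M = "curve_E b"
  have disc: "discriminant (change_vars u r s t ?W) = discriminant ?M * (of_int w / u) ^ 12"
    if "u \<noteq> 0" for u r s t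
    unfolding discriminant_change_vars_curve_E[OF that] discriminant_curve_E a
    using that by (simp add: power_divide power_mult_distrib flip: power_mult)
  have integral: "padic_integral p (of_int w / u)"
    if "prime p" "u \<noteq> 0" "\<forall>c\<in>wcoeffs (change_vars u r s t ?W). padic_integral p c" for p u r s t
  proof -
    have "of_int a / u ^ 4 = of_int b * (of_int w / u) ^ 4" by (simp add: a power_divide)
    then show ?thesis
      using padic_integral_a4_quotient[OF that] padic_integral_power_cancel free that(1) by metis
  qed
  have M0: "discriminant ?M \<noteq> 0" using assms by (simp add: discriminant_curve_E)
  have "?M = change_vars (of_int w) 0 0 0 ?W"
    using assms by (simp add: change_vars_def curve_E_def)
  then have model: "weierstrass_model ?W ?M"
    unfolding weierstrass_model_def using \<open>w \<noteq> 0\<close> by (metis of_int_eq_0_iff)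
  have int: "wcoeffs ?M \<subseteq> \<int>" by (simp add: wcoeffs_def curve_E_def)
  have pint: "\<forall>c\<in>wcoeffs M. padic_integral p c" if "wcoeffs M \<subseteq> \<int>" "prime p" for M p
    using that padic_integral_of_int by (metis Ints_cases subsetD)
  have "minimal_model_at p ?W ?M" if p: "prime p" for p
    unfolding minimal_model_at_def
  proof (intro conjI allI impI model pint int p)
    fix M' assume "weierstrass_model ?W M' \<and> (\<forall>c\<in>wcoeffs M'. padic_integral p c)"
    then obtain u r s t where u: "u \<noteq> 0" "M' = change_vars u r s t ?W"
      and M': "\<forall>c\<in>wcoeffs M'. padic_integral p c" unfolding weierstrass_model_def by blast
    have "padic_val p (of_int w / u) \<ge> 0"
      using integral[OF p u(1)] M' u(2) padic_val_nonneg by blast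
    then show "padic_val p (discriminant ?M) \<le> padic_val p (discriminant M')"
      unfolding u(2) disc[OF u(1)] using M0 u(1) \<open>w \<noteq> 0\<close> p
      by (simp add: padic_val_mult padic_val_power)
  qed
  then have glob: "global_minimal_model ?W ?M"
    unfolding global_minimal_model_def using model int by blast
  \<comment> \<open>The definite description needs uniqueness: for a second global minimal model,
    \<open>w/u\<close> has valuation zero at every prime, so it is \<open>1\<close> or
    \<open>-1\<close>.\<close>
  have uniq: "\<bar>discriminant M\<bar> = \<bar>discriminant ?M\<bar>" if M: "global_minimal_model ?W M" for M
  proof -
    obtain u r s t where u: "u \<noteq> 0" "M = change_vars u r s t ?W"
      using M unfolding global_minimal_model_def weierstrass_model_def by blast
    define q where "q = of_int w / u"
    have "q \<noteq> 0" using u \<open>w \<noteq> 0\<close> by (simp add: q_def)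
    have i: "padic_integral p q" if "prime p" for p
      using integral[OF that u(1)] M that u(2) unfolding q_def global_minimal_model_def minimal_model_at_def by blast
    have v: "padic_val p q \<le> 0" if p: "prime p" for p
    proof -
      have "padic_val p (discriminant M) \<le> padic_val p (discriminant ?M)"
        using M p model pint[OF int p] unfolding global_minimal_model_def minimal_model_at_def by blast
      then show ?thesis unfolding u(2) disc[OF u(1)] q_def[symmetric]
        using M0 \<open>q \<noteq> 0\<close> p by (simp add: padic_val_mult padic_val_power)
    qed
    obtain m n where mn: "quotient_of q = (m, n)" "q = of_int m / of_int n" "n > 0" "coprime m n"
      by (rule quotient_ofE)
    have n: "n = 1"
    proof (rule ccontr)
      assume "n \<noteq> 1"
      then obtain p where "prime p" "p dvd n" using mn(3) prime_divisor_exists[of n] by auto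
      then have "prime (nat p)" "int (nat p) dvd n" by (simp_all add: prime_ge_0_int prime_nat_iff_prime)
      then show False using i[of "nat p"] mn(1) by (auto simp: padic_integral_def)
    qed
    have "is_unit m"
    proof (rule ccontr)
      assume "\<not> is_unit m"
      moreover have "m \<noteq> 0" using \<open>q \<noteq> 0\<close> mn by auto
      ultimately obtain p where p: "prime p" "p dvd m" using prime_divisor_exists[of m] by auto
      then have "prime (nat p)" "int (nat p) = p" by (simp_all add: prime_ge_0_int prime_nat_iff_prime)
      moreover have "multiplicity p m > 0" using p \<open>m \<noteq> 0\<close>
        by (metis gr0I multiplicity_eq_zero_iff not_prime_unit)
      ultimately show False using v[of "nat p"] mn(1) n by (simp add: padic_val_def)
    qed
    then have "q = 1 \<or> q = -1" using mn n by (auto simp: zdvd1_eq)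
    then show ?thesis unfolding u(2) disc[OF u(1)] q_def[symmetric] by auto
  qed
  have abs: "of_nat (nat (64 * \<bar>b\<bar> ^ 3)) = \<bar>discriminant ?M\<bar>"
    by (simp add: discriminant_curve_E abs_mult power_abs)
  show ?thesis unfolding minimal_discriminant_def
  proof (rule the_equality)
    show "\<exists>M. global_minimal_model ?W M \<and> of_nat (nat (64 * \<bar>b\<bar> ^ 3)) = \<bar>discriminant M\<bar>"
      using glob abs by blast
  next
    fix d assume "\<exists>M. global_minimal_model ?W M \<and> of_nat d = \<bar>discriminant M\<bar>"
    then have "(of_nat d :: rat) = of_nat (nat (64 * \<bar>b\<bar> ^ 3))" using uniq abs by metis
    then show "d = nat (64 * \<bar>b\<bar> ^ 3)" by (simp only: of_nat_eq_iff)
  qed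
qed

lemma fourth_power_free_decomposition:
  fixes a :: int
  assumes "a \<noteq> 0"
  obtains w b where "a = w ^ 4 * b" "w > 0" "b \<noteq> 0" "\<And>p. prime p \<Longrightarrow> \<not> int p ^ 4 dvd b"
proof -
  have "\<exists>w b. a = w ^ 4 * b \<and> w > 0 \<and> b \<noteq> 0 \<and> (\<forall>p. prime p \<longrightarrow> \<not> int p ^ 4 dvd b)"
    using assms
  proof (induction "nat \<bar>a\<bar>" arbitrary: a rule: less_induct)
    case less
    show ?case
    proof (cases "\<exists>p. prime p \<and> int p ^ 4 dvd a")
      case False
      then show ?thesis using less.prems by (intro exI[of _ 1] exI[of _ a]) auto
    next
      case True
      then obtain p c where p: "prime p" and c: "a = int p ^ 4 * c" by auto
      have "int p ^ 4 > 1" using prime_gt_1_nat[OF p] by simp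
      moreover have "c \<noteq> 0" using c less.prems by auto
      ultimately have "\<bar>c\<bar> < \<bar>a\<bar>" unfolding c by (simp add: abs_mult)
      then have "nat \<bar>c\<bar> < nat \<bar>a\<bar>" by linarith
      then obtain w b where "c = w ^ 4 * b" "w > 0" "b \<noteq> 0" "\<forall>p. prime p \<longrightarrow> \<not> int p ^ 4 dvd b"
        using less.hyps[of c] \<open>c \<noteq> 0\<close> by blast
      then show ?thesis using c prime_gt_0_nat[OF p]
        by (intro exI[of _ "int p * w"] exI[of _ b]) (auto simp: power_mult_distrib)
    qed
  qed
  then show ?thesis using that by blast
qed

subsection \<open>Cancellation in the first two doublings\<close>

lemma quotient_of_fract_coprime:
  assumes "coprime m n" "n \<noteq> 0"
  shows "quotient_of (of_int m / of_int n) = (if n > 0 then (m, n) else (- m, - n))"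
  using assms unfolding Fract_of_int_quotient[symmetric] quotient_of_Fract
  by (simp add: Rat.normalize_def)

lemma rat_square_int:
  assumes "(q::rat)^2 = of_int N"
  obtains m where "q = of_int m"
proof -
  obtain m n where q: "q = of_int m / of_int n" and n: "n > 0" and c: "coprime m n"
    by (rule quotient_ofE)
  have "of_int m = q * of_int n" using n unfolding q by simp
  then have "of_int (m^2) = (of_int (N * n^2) :: rat)"
    by (simp add: power_mult_distrib assms(1))
  then have e: "m^2 = N * n^2" by (simp only: of_int_eq_iff)
  have "n dvd m^2" unfolding e by (simp add: power2_eq_square)
  moreover have "coprime n (m^2)" using c by (metis coprime_commute coprime_power_right_iff)
  ultimately have "is_unit n" by (metis coprime_common_divisor dvd_refl)
  then have "n = 1" using n by simp
  with q that show ?thesis by simp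
qed

lemma coprimeI_primes:
  fixes a b :: "'a::factorial_semiring_gcd"
  assumes "a \<noteq> 0" "\<And>p. prime p \<Longrightarrow> p dvd a \<Longrightarrow> \<not> p dvd b"
  shows "coprime a b"
proof (rule ccontr)
  assume "\<not> coprime a b"
  then have "\<not> is_unit (gcd a b)" using is_unit_gcd by blast
  moreover have "gcd a b \<noteq> 0" using assms(1) by simp
  ultimately obtain p where "prime p" "p dvd gcd a b" using prime_divisor_exists by blast
  then show False using assms(2)[of p] by simp
qed

lemma odd_prime_not_dvd_two:
  assumes "prime (p::int)" "p \<noteq> 2"
  shows "\<not> p dvd 2"
  using assms primes_dvd_imp_eq[of p 2] by auto

text \<open>For the point with abscissa \<open>X / T\<close> and ordinate \<open>Y / T^2\<close>,
  \<open>k / s\<close> is a square root of the abscissa of its double. If \<open>p\<close> divides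
  both \<open>k\<close> and \<open>b\<close>, the factor \<open>k\<close> keeps
  \<open>s (X^2 - b T^2)\<close> divisible by \<open>p\<close> even after common factors are
  cancelled. So \<open>p\<close> can be split off from \<open>X\<close>, \<open>Y\<close> and
  \<open>b\<close> again and again until \<open>b\<close> has lost four factors.\<close>

lemma doubling_numerator_not_dvd:
  fixes b X T Y k s p :: int
  assumes p: "prime p" "p \<noteq> 2" and b: "p dvd b" "\<not> p^4 dvd b"
    and XT: "coprime X T" and ks: "coprime k s"
    and Y: "Y^2 = T * X * (X^2 + b * T^2)" and k: "k * (2 * Y) = s * (X^2 - b * T^2)"
  shows "\<not> p dvd k"
proof
  assume pk: "p dvd k"
  have p0: "p \<noteq> 0" using p by auto
  have ps: "\<not> p dvd s" using ks pk p(1) by (meson coprime_common_divisor not_prime_unit)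
  have sq: "p dvd z" if "p dvd z^2" for z using that p(1) prime_dvd_power by blast
  have "p dvd s * (X^2 - b * T^2)" unfolding k[symmetric] using pk by auto
  then have "p dvd X^2 - b * T^2" using ps p(1) prime_dvd_mult_iff by blast
  then have pX: "p dvd X" using b(1) sq by (metis dvd_diff_left_iff dvd_mult2)
  then have pT: "\<not> p dvd T" using XT p(1) by (meson coprime_common_divisor not_prime_unit)
  obtain X1 b1 where X1: "X = p * X1" and b1: "b = p * b1" using pX b(1) by (elim dvdE)
  have Ya: "Y^2 = p^2 * (T * X1 * (p * X1^2 + b1 * T^2))"
    unfolding Y X1 b1 by (simp add: algebra_simps power2_eq_square)
  have "p dvd Y" by (rule sq) (unfold Ya, simp add: power2_eq_square mult.assoc)
  then obtain Y1 where Y1: "Y = p * Y1" by (elim dvdE)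
  have Yb: "Y1^2 = T * X1 * (p * X1^2 + b1 * T^2)"
    using Ya p0 unfolding Y1 by (simp add: power_mult_distrib)
  have "p * (k * (2 * Y1)) = p * (s * (p * X1^2 - b1 * T^2))"
    using k unfolding Y1 X1 b1 by (simp add: algebra_simps power2_eq_square)
  then have kb: "k * (2 * Y1) = s * (p * X1^2 - b1 * T^2)" using p0 by simp
  then have "p dvd s * (p * X1^2 - b1 * T^2)" using pk by (metis dvd_mult2)
  then have "p dvd p * X1^2 - b1 * T^2" using ps p(1) prime_dvd_mult_iff by blast
  then have "p dvd b1 * T^2" by (metis dvd_diff_right_iff dvd_triv_left)
  then have "p dvd b1" using pT sq p(1) prime_dvd_mult_iff by blast
  then obtain b2 where b2: "b1 = p * b2" by (elim dvdE)
  have Yc: "Y1^2 = p * (T * X1 * (X1^2 + b2 * T^2))"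
    unfolding Yb b2 by (simp add: algebra_simps power2_eq_square)
  have "p dvd Y1" by (rule sq) (unfold Yc, simp)
  then obtain Y2 where Y2: "Y1 = p * Y2" by (elim dvdE)
  have "p * (p * Y2^2) = p * (T * X1 * (X1^2 + b2 * T^2))"
    using Yc unfolding Y2 by (simp add: algebra_simps power2_eq_square)
  then have Yd: "p * Y2^2 = T * X1 * (X1^2 + b2 * T^2)" using p0 by simp
  have "p * (k * (2 * Y2)) = p * (s * (X1^2 - b2 * T^2))"
    using kb unfolding Y2 b2 by (simp add: algebra_simps)
  then have kd: "k * (2 * Y2) = s * (X1^2 - b2 * T^2)" using p0 by simp
  then have "p dvd s * (X1^2 - b2 * T^2)" using pk by (metis dvd_mult2)
  then have m: "p dvd X1^2 - b2 * T^2" using ps p(1) prime_dvd_mult_iff by blast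
  have "p dvd T * X1 * (X1^2 + b2 * T^2)" using Yd by (metis dvd_triv_left)
  then have "p dvd X1 \<or> p dvd X1^2 + b2 * T^2" using pT p(1) prime_dvd_mult_iff by blast
  then have "p dvd X1"
  proof
    \<comment> \<open>Adding the two forms leaves \<open>2 X1^2\<close>; here \<open>p\<close> odd
      enters.\<close>
    assume "p dvd X1^2 + b2 * T^2"
    then have "p dvd (X1^2 + b2 * T^2) + (X1^2 - b2 * T^2)" using m by (rule dvd_add)
    then have "p dvd 2 * X1^2" by simp
    moreover have "\<not> p dvd 2" using p odd_prime_not_dvd_two by blast
    ultimately show "p dvd X1" using sq p(1) prime_dvd_mult_iff by blast
  qed
  then obtain X2 where X2: "X1 = p * X2" by (elim dvdE)
  have "p dvd X1^2" using \<open>p dvd X1\<close> by (simp add: power2_eq_square)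
  then have "p dvd b2 * T^2" using m by (metis dvd_diff_right_iff)
  then have "p dvd b2" using pT sq p(1) prime_dvd_mult_iff by blast
  then obtain b3 where b3: "b2 = p * b3" by (elim dvdE)
  have "p * Y2^2 = p * (p * (T * X2 * (p * X2^2 + b3 * T^2)))"
    unfolding Yd X2 b3 by (simp add: algebra_simps power2_eq_square)
  then have "Y2^2 = p * (T * X2 * (p * X2^2 + b3 * T^2))" using p0 by simp
  then have "p dvd Y2^2" by (metis dvd_triv_left)
  then have "p dvd Y2" by (rule sq)
  then obtain Y3 where Y3: "Y2 = p * Y3" by (elim dvdE)
  have "p * (k * (2 * Y3)) = p * (s * (p * X2^2 - b3 * T^2))"
    using kd unfolding Y3 X2 b3 by (simp add: algebra_simps power2_eq_square)
  then have "k * (2 * Y3) = s * (p * X2^2 - b3 * T^2)" using p0 by simp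
  then have "p dvd s * (p * X2^2 - b3 * T^2)" using pk by (metis dvd_mult2)
  then have "p dvd p * X2^2 - b3 * T^2" using ps p(1) prime_dvd_mult_iff by blast
  then have "p dvd b3 * T^2" by (metis dvd_diff_right_iff dvd_triv_left)
  then have "p dvd b3" using pT sq p(1) prime_dvd_mult_iff by blast
  then have "p^4 dvd b" unfolding b1 b2 b3 by (auto simp: power4_eq_xxxx)
  with b(2) show False ..
qed

lemma first_doubling:
  fixes \<xi> \<eta> :: rat and b :: int
  assumes curve: "\<eta>^2 = \<xi>^3 + of_int b * \<xi>" and "\<eta> \<noteq> 0"
    and free: "\<And>p. prime p \<Longrightarrow> \<not> int p ^ 4 dvd b"
  obtains k s where "coprime k s" "s > 0" "(\<xi>^2 - of_int b) / (2 * \<eta>) = of_int k / of_int s"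
    "\<And>p::int. prime p \<Longrightarrow> p \<noteq> 2 \<Longrightarrow> p dvd k \<Longrightarrow> \<not> p dvd b"
proof -
  obtain X T where \<xi>: "\<xi> = of_int X / of_int T" and T: "T > 0" and cXT: "coprime X T"
    by (rule quotient_ofE)
  obtain k s where k: "(\<xi>^2 - of_int b) / (2 * \<eta>) = of_int k / of_int s"
    and s: "s > 0" and cks: "coprime k s"
    by (rule quotient_ofE)
  have T0: "of_int T \<noteq> (0::rat)" and s0: "of_int s \<noteq> (0::rat)" using T s by auto
  have X: "of_int X = \<xi> * of_int T" using \<xi> T0 by simp
  \<comment> \<open>Multiplication by \<open>T^2\<close> makes the ordinate integral, as its square
    is then an integer; \<open>T\<close> need not be recognised as a square.\<close>
  have "(of_int T^2 * \<eta>)^2 = of_int (T * X * (X^2 + b * T^2))"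
    unfolding power_mult_distrib curve of_int_mult of_int_add of_int_power X by algebra
  then obtain Y where Y: "of_int T^2 * \<eta> = of_int Y" using rat_square_int by metis
  have "of_int (Y^2) = (of_int (T * X * (X^2 + b * T^2)) :: rat)"
    using \<open>(of_int T^2 * \<eta>)^2 = _\<close> unfolding Y by simp
  then have Y2: "Y^2 = T * X * (X^2 + b * T^2)" by (simp only: of_int_eq_iff)
  have kk: "of_int k * (2 * \<eta>) = of_int s * (\<xi>^2 - of_int b)"
    using k s0 \<open>\<eta> \<noteq> 0\<close> by (simp add: field_simps)
  have "of_int (k * (2 * Y)) = (of_int (s * (X^2 - b * T^2)) :: rat)"
    unfolding of_int_mult of_int_diff of_int_power X Y[symmetric] of_int_numeral using kk by algebra
  then have k2: "k * (2 * Y) = s * (X^2 - b * T^2)" by (simp only: of_int_eq_iff)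
  have "\<not> p dvd b" if p: "prime p" "p \<noteq> 2" "p dvd k" for p :: int
  proof
    assume "p dvd b"
    moreover have "\<not> p ^ 4 dvd b" using free[of "nat p"] p(1)
      by (simp add: prime_ge_0_int prime_nat_iff_prime)
    ultimately show False
      using doubling_numerator_not_dvd[OF p(1,2) _ _ cXT cks Y2 k2] p(3) by blast
  qed
  then show ?thesis using that[OF cks s k] by blast
qed

lemma two_power_part:
  fixes u v :: int
  assumes "g \<noteq> 0" "u = g * n" "v = g * d" "odd n" "even d"
    and odd_primes: "\<And>p. prime p \<Longrightarrow> p \<noteq> 2 \<Longrightarrow> p dvd u \<Longrightarrow> \<not> p dvd v"
  shows "coprime n d"
proof (rule coprimeI_primes)
  show "n \<noteq> 0" using \<open>odd n\<close> by auto
next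
  fix p :: int
  assume p: "prime p" "p dvd n"
  then have "p \<noteq> 2" using \<open>odd n\<close> by auto
  then show "\<not> p dvd d" using p odd_primes[of p] assms(2,3) by auto
qed

lemma odd_fourth_power_mod_16:
  fixes m :: int
  assumes "odd m"
  shows "m^4 mod 16 = 1"
proof -
  obtain c where c: "m = 2 * c + 1" using assms by (elim oddE)
  have "even (c * (c + 1))" by simp
  then obtain e where e: "c * (c + 1) = 2 * e" by (elim evenE)
  have "m^2 = 4 * (c * (c + 1)) + 1" unfolding c by (simp add: algebra_simps power2_eq_square)
  then have "m^2 = 8 * e + 1" using e by simp
  moreover have "m^4 = (m^2)^2" by simp
  ultimately have "m^4 = 1 + 16 * (4 * e^2 + e)" by (simp add: algebra_simps power2_eq_square)
  then show ?thesis by (simp only: mod_mult_self2) simp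
qed

text \<open>\<open>(k/s)^2\<close> is the abscissa of \<open>2P\<close> and
  \<open>((k^4 - b s^4) / (2 k s m))^2\<close> that of \<open>4P\<close>. An odd prime in both
  numerator and denominator would divide \<open>k\<close>, and then \<open>b\<close> or
  \<open>s\<close>; so only the power \<open>g\<close> of 2 cancels.\<close>

lemma second_doubling:
  fixes b k s m :: int
  assumes ks: "coprime k s" and m: "m^2 = k^4 + b * s^4" and b: "\<not> 16 dvd b"
    and odd_primes: "\<And>p. prime p \<Longrightarrow> p \<noteq> 2 \<Longrightarrow> p dvd k \<Longrightarrow> \<not> p dvd b"
  obtains g n d where "g \<in> {1, 2, 4}" "k^4 - b * s^4 = g * n" "2 * k * s * m = g * d"
    "odd n" "even d" "coprime n d" "coprime n b"
proof -
  have cop: "\<not> p dvd 2 * k * s * m" if p: "prime p" "p \<noteq> 2" "p dvd k^4 - b * s^4" for p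
  proof
    assume "p dvd 2 * k * s * m"
    moreover have p2: "\<not> p dvd 2" using p odd_prime_not_dvd_two by blast
    ultimately consider "p dvd k" | "p dvd s" | "p dvd m" using p(1) prime_dvd_mult_iff by metis
    then have "p dvd k"
    proof cases
      case 2
      then have "p dvd b * s^4" unfolding power4_eq_xxxx by simp
      then have "p dvd k^4" using p(3) by (metis dvd_diff_left_iff)
      then show ?thesis using p(1) prime_dvd_power by blast
    next
      case 3
      then have "p dvd k^4 + b * s^4" unfolding m[symmetric] power2_eq_square by simp
      then have "p dvd (k^4 + b * s^4) + (k^4 - b * s^4)" using p(3) by (rule dvd_add)
      then have "p dvd 2 * k^4" by simp
      then show ?thesis using p(1) p2 prime_dvd_power prime_dvd_mult_iff by blast
    qed
    then have "p dvd k^4" unfolding power4_eq_xxxx by simp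
    then have "p dvd b * s^4" using p(3) by (metis dvd_diff_right_iff)
    then have "p dvd b \<or> p dvd s" using p(1) prime_dvd_power prime_dvd_mult_iff by blast
    then show False using odd_primes[OF p(1,2) \<open>p dvd k\<close>] \<open>p dvd k\<close> ks p(1)
      by (meson coprime_common_divisor not_prime_unit)
  qed
  have "\<exists>g n d. g \<in> {1, 2, 4} \<and> k^4 - b * s^4 = g * n \<and> 2 * k * s * m = g * d \<and> odd n \<and> even d"
  proof (cases "even (k^4 - b * s^4)")
    case False
    then show ?thesis
      by (intro exI[of _ 1] exI[of _ "k^4 - b * s^4"] exI[of _ "2 * k * s * m"]) simp
  next
    case True
    have "odd s"
    proof
      assume "even s"
      then have "even k" using True by auto
      with \<open>even s\<close> ks show False by (meson coprime_common_divisor odd_one)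
    qed
    then obtain s' where s': "s^4 = 16 * s' + 1"
      using odd_fourth_power_mod_16[of s] mult_div_mod_eq[of 16 "s^4"] by metis
    have "even m"
    proof -
      have "even ((k^4 - b * s^4) + 2 * (b * s^4))" using True by (rule dvd_add) simp
      then have "even (m^2)" unfolding m by simp
      then show ?thesis by simp
    qed
    then obtain c where c: "m = 2 * c" by (elim evenE)
    \<comment> \<open>With \<open>m\<close> even, the 2-part of \<open>2 k^4 - m^2\<close> is
      exactly 2 for odd \<open>k\<close>. For even \<open>k\<close> it is exactly 4, because
      \<open>4 dvd m\<close> would give \<open>16 dvd b\<close>.\<close>
    have D: "k^4 - b * s^4 = 2 * k^4 - m^2" unfolding m by simp
    show ?thesis
    proof (cases "even k")
      case False
      then obtain x where x: "k^4 = 16 * x + 1"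
        using odd_fourth_power_mod_16[of k] mult_div_mod_eq[of 16 "k^4"] by metis
      have "k^4 - b * s^4 = 2 * (2 * (8 * x - c^2) + 1)"
        unfolding D unfolding x c by (simp add: power_mult_distrib)
      then show ?thesis using c
        by (intro exI[of _ 2] exI[of _ "2 * (8 * x - c^2) + 1"] exI[of _ "k * s * m"]) simp
    next
      case True
      then obtain e where e: "k = 2 * e" by (elim evenE)
      have "odd c"
      proof
        assume "even c"
        then obtain f where "c = 2 * f" by (elim evenE)
        then have "b = 16 * (f^2 - e^4 - b * s')"
          using m unfolding c e s' by (simp add: power_mult_distrib algebra_simps)
        with b show False by (metis dvd_triv_left)
      qed
      moreover have "k^4 - b * s^4 = 4 * (8 * e^4 - c^2)"
        unfolding D unfolding e c by (simp add: power_mult_distrib)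
      moreover have "2 * k * s * m = 4 * (2 * (e * s * c))" unfolding e c by simp
      ultimately show ?thesis
        by (intro exI[of _ 4] exI[of _ "8 * e^4 - c^2"] exI[of _ "2 * (e * s * c)"]) simp
    qed
  qed
  then obtain g n d where g: "g \<in> {1, 2, 4}" "k^4 - b * s^4 = g * n" "2 * k * s * m = g * d"
    "odd n" "even d" by blast
  then have "g \<noteq> 0" by auto
  then have "coprime n d" using two_power_part[OF _ g(2-5)] cop by blast
  moreover have "coprime n b"
  proof (rule coprimeI_primes)
    show "n \<noteq> 0" using \<open>odd n\<close> by auto
  next
    fix p :: int
    assume p: "prime p" "p dvd n"
    then have "p \<noteq> 2" using \<open>odd n\<close> by auto
    show "\<not> p dvd b"
    proof
      assume "p dvd b"
      have "p dvd k^4 - b * s^4" using p(2) g(2) by simp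
      then have "p dvd k^4" using \<open>p dvd b\<close> by (metis dvd_diff_left_iff dvd_mult2)
      then have "p dvd k" using p(1) prime_dvd_power by blast
      with odd_primes[OF p(1) \<open>p \<noteq> 2\<close>] \<open>p dvd b\<close> show False by blast
    qed
  qed
  ultimately show ?thesis using that g by blast
qed

subsection \<open>Growth of the height under doubling\<close>

text \<open>For \<open>b > 0\<close> this is the norm of \<open>r + t sqrt(-b)\<close>. It replaces
  the maximum of \<open>|r|\<close> and \<open>|t|\<close> because doubling raises it at least to
  its fourth power, with no constant lost.\<close>

definition twisted_norm :: "int \<Rightarrow> rat \<Rightarrow> int" where
  "twisted_norm b q = (case quotient_of q of (r, t) \<Rightarrow> r^2 + \<bar>b\<bar> * t^2)"

lemma twisted_norm_fract:
  "coprime r t \<Longrightarrow> t \<noteq> 0 \<Longrightarrow> twisted_norm b (of_int r / of_int t) = r^2 + \<bar>b\<bar> * t^2"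
  by (simp add: twisted_norm_def quotient_of_fract_coprime)

lemma rat_height_fract:
  "coprime r t \<Longrightarrow> t \<noteq> 0 \<Longrightarrow>
    rat_height (of_int r / of_int t) = ln (real_of_int (max \<bar>r\<bar> \<bar>t\<bar>))"
  by (simp add: rat_height_def quotient_of_fract_coprime)

lemma twisted_norm_pos: "b \<noteq> 0 \<Longrightarrow> twisted_norm b q > 0"
  by (rule quotient_ofE[of q]) (auto simp: twisted_norm_def intro!: add_nonneg_pos mult_pos_pos)

text \<open>With \<open>M\<close> the maximum of \<open>|r|\<close> and \<open>|t|\<close>,
  \<open>M^2 \<le> N \<le> (1 + |b|) M^2\<close>. A bounded error disappears in the limit defining
  the canonical height.\<close>

lemma rat_height_twisted_norm:
  assumes b: "b \<noteq> 0"
  shows "\<bar>rat_height q - ln (real_of_int (twisted_norm b q)) / 2\<bar> \<le> ln (1 + real_of_int \<bar>b\<bar>) / 2"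
proof -
  obtain r t where q: "q = of_int r / of_int t" "t > 0" "coprime r t"
    by (rule quotient_ofE)
  define M where "M = max \<bar>r\<bar> \<bar>t\<bar>"
  define N where "N = twisted_norm b q"
  have N: "N = r^2 + \<bar>b\<bar> * t^2" unfolding N_def q(1) using q by (simp add: twisted_norm_fract)
  have M: "rat_height q = ln (real_of_int M)" unfolding M_def q(1) using q by (simp add: rat_height_fract)
  have "M > 0" unfolding M_def using q by auto
  have b1: "\<bar>b\<bar> \<ge> 1" using b by linarith
  have rM: "r^2 \<le> M^2" and tM: "t^2 \<le> M^2"
    unfolding M_def by (simp_all flip: abs_le_square_iff)
  have tb: "1 * t^2 \<le> \<bar>b\<bar> * t^2" using b1 by (intro mult_right_mono) auto
  have "\<bar>b\<bar> * t^2 \<le> \<bar>b\<bar> * M^2" using tM by (intro mult_left_mono) auto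
  then have up: "N \<le> (1 + \<bar>b\<bar>) * M^2" using rM unfolding N by (simp add: algebra_simps)
  have "M^2 = r^2 \<or> M^2 = t^2" unfolding M_def by (auto simp: max_def)
  moreover have "r^2 \<ge> 0" "\<bar>b\<bar> * t^2 \<ge> 0" by simp_all
  ultimately have low: "M^2 \<le> N" using tb unfolding N by linarith
  have "N > 0" using twisted_norm_pos[OF b] by (simp add: N_def)
  have "ln (real_of_int N) \<le> ln (real_of_int ((1 + \<bar>b\<bar>) * M^2))"
    using up \<open>N > 0\<close> \<open>M > 0\<close> by (intro ln_mono) (simp_all del: of_int_mult of_int_add)
  also have "\<dots> = ln (1 + real_of_int \<bar>b\<bar>) + 2 * ln (real_of_int M)"
    using \<open>M > 0\<close> by (simp add: ln_mult ln_realpow add_pos_nonneg)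
  finally have 1: "ln (real_of_int N) \<le> ln (1 + real_of_int \<bar>b\<bar>) + 2 * ln (real_of_int M)" .
  have "ln (real_of_int (M^2)) \<le> ln (real_of_int N)"
    using low \<open>N > 0\<close> \<open>M > 0\<close> by (intro ln_mono) (simp_all del: of_int_power)
  then have 2: "2 * ln (real_of_int M) \<le> ln (real_of_int N)" using \<open>M > 0\<close> by (simp add: ln_realpow)
  have "ln (1 + real_of_int \<bar>b\<bar>) \<ge> 0" by simp
  with 1 2 show ?thesis unfolding M N_def[symmetric] by linarith
qed

lemma rat_height_fract_le:
  assumes "n \<noteq> 0"
  shows "rat_height (of_int m / of_int n) \<le> ln (real_of_int (max \<bar>m\<bar> \<bar>n\<bar>))"
proof -
  define g where "g = gcd m n"
  have "g > 0" using assms by (simp add: g_def)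
  obtain r t where rt: "m = g * r" "n = g * t" "coprime r t"
    unfolding g_def using gcd_coprime_exists[of m n] assms
    by (metis gcd_eq_0_iff mult.commute)
  have "of_int m / of_int n = (of_int r / of_int t :: rat)" using \<open>g > 0\<close> by (simp add: rt)
  moreover have "t \<noteq> 0" using assms rt by auto
  moreover have "max \<bar>r\<bar> \<bar>t\<bar> \<le> max \<bar>m\<bar> \<bar>n\<bar>"
  proof -
    have "z \<le> g * z" if "z \<ge> 0" for z using that \<open>g > 0\<close> mult_right_mono[of 1 g z] by simp
    then have "\<bar>r\<bar> \<le> \<bar>m\<bar>" "\<bar>t\<bar> \<le> \<bar>n\<bar>" using \<open>g > 0\<close> by (simp_all add: rt abs_mult)
    then show ?thesis by linarith
  qed
  ultimately show ?thesis using rt(3)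
    by (simp add: rat_height_fract) (intro ln_mono; auto simp: less_max_iff_disj)
qed

text \<open>Applied to a factor and to its inverse, this bounds the change of height under rescaling
  from both sides.\<close>

lemma rat_height_scale_le:
  fixes c d :: int
  assumes "c \<noteq> 0" "d \<noteq> 0"
  shows "rat_height (of_int c / of_int d * q) \<le> ln (real_of_int (max \<bar>c\<bar> \<bar>d\<bar>)) + rat_height q"
proof -
  obtain r t where q: "q = of_int r / of_int t" "t > 0" "coprime r t"
    by (rule quotient_ofE)
  have "rat_height (of_int c / of_int d * q) \<le> ln (real_of_int (max \<bar>c * r\<bar> \<bar>d * t\<bar>))"
    using rat_height_fract_le[of "d * t" "c * r"] assms q by simp
  also have "\<dots> \<le> ln (real_of_int (max \<bar>c\<bar> \<bar>d\<bar> * max \<bar>r\<bar> \<bar>t\<bar>))"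
  proof (rule ln_mono)
    have "\<bar>c * r\<bar> \<le> max \<bar>c\<bar> \<bar>d\<bar> * max \<bar>r\<bar> \<bar>t\<bar>" "\<bar>d * t\<bar> \<le> max \<bar>c\<bar> \<bar>d\<bar> * max \<bar>r\<bar> \<bar>t\<bar>"
      unfolding abs_mult by (intro mult_mono; simp)+
    then show "real_of_int (max \<bar>c * r\<bar> \<bar>d * t\<bar>) \<le> real_of_int (max \<bar>c\<bar> \<bar>d\<bar> * max \<bar>r\<bar> \<bar>t\<bar>)"
      by (simp only: of_int_le_iff max.bounded_iff)
  qed (use assms q in \<open>auto simp: less_max_iff_disj\<close>)
  also have "\<dots> = ln (real_of_int (max \<bar>c\<bar> \<bar>d\<bar>)) + ln (real_of_int (max \<bar>r\<bar> \<bar>t\<bar>))"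
    unfolding of_int_mult using assms q by (intro ln_mult_pos) (auto simp: less_max_iff_disj)
  also have "ln (real_of_int (max \<bar>r\<bar> \<bar>t\<bar>)) = rat_height q"
    unfolding q(1) using q by (simp add: rat_height_fract)
  finally show ?thesis .
qed

text \<open>For \<open>b \<ge> 0\<close>, \<open>N' = (D + 8 c)^2\<close> against
  \<open>N^4 = (D + 4 c)^2\<close>; for \<open>b < 0\<close>, \<open>r^2 - b t^2\<close> is
  \<open>N\<close> itself and \<open>N' - N^4 = 16 c D\<close>. The lower constant 1 decides the
  final bound; the upper constant 5 is not sharp and serves only convergence.\<close>

lemma norm_form_doubling:
  fixes b r t :: int
  defines "N \<equiv> r^2 + \<bar>b\<bar> * t^2" and "N' \<equiv> ((r^2 - b * t^2)^2)^2 + \<bar>b\<bar> * (4 * r * t * (r^2 + b * t^2))^2"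
  shows "N^4 \<le> N'" "N' \<le> 5 * N^4"
proof -
  define c where "c = r^2 * (\<bar>b\<bar> * t^2)"
  define D where "D = (r^2 - \<bar>b\<bar> * t^2)^2"
  have c0: "c \<ge> 0" by (simp add: c_def)
  have D0: "D \<ge> 0" by (simp add: D_def)
  have S: "N^2 = D + 4 * c" unfolding N_def c_def D_def by algebra
  have S4: "N^4 = (D + 4 * c)^2" unfolding S[symmetric] by simp
  have "N^4 \<le> N' \<and> N' \<le> 5 * N^4"
  proof (cases "b \<ge> 0")
    case True
    then have "N' = D^2 + 16 * c * (D + 4 * c)"
      unfolding N'_def D_def c_def by simp algebra
    moreover have "c * D \<ge> 0" "c^2 \<ge> 0" "D^2 \<ge> 0" using c0 D0 by simp_all
    ultimately show ?thesis unfolding S4 by (auto simp: algebra_simps power2_eq_square)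
  next
    case False
    then have "N' = (D + 4 * c)^2 + 16 * c * D"
      unfolding N'_def D_def c_def by simp algebra
    moreover have "c * D \<ge> 0" "c^2 \<ge> 0" "D^2 \<ge> 0" using c0 D0 by simp_all
    ultimately show ?thesis unfolding S4 by (auto simp: algebra_simps power2_eq_square)
  qed
  then show "N^4 \<le> N'" "N' \<le> 5 * N^4" by auto
qed

text \<open>For such \<open>q = r / t\<close> no cancellation occurs in the duplication formula.\<close>

definition good_reduced :: "int \<Rightarrow> rat \<Rightarrow> bool" where
  "good_reduced b q \<longleftrightarrow> (\<exists>r t. q = of_int r / of_int t \<and> t \<noteq> 0 \<and> coprime r t \<and> coprime r b \<and> odd r \<and> even t)"

text \<open>\<open>r\<close> odd and \<open>t\<close> even make the new numerator odd. A prime that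
  it shares with the new denominator or with \<open>b\<close> would divide \<open>r\<close>, hence
  \<open>b\<close> or \<open>t\<close>, against coprimality. The duplication formula is thus already
  in lowest terms, and \<open>norm_form_doubling\<close> applies as it stands.\<close>

lemma good_reduced_doubling:
  fixes q :: rat and b :: int
  assumes g: "good_reduced b q" and nz: "q^3 + of_int b * q \<noteq> 0"
  defines "q' \<equiv> (q^2 - of_int b)^2 / (4 * (q^3 + of_int b * q))"
  shows "good_reduced b q'" "twisted_norm b q ^ 4 \<le> twisted_norm b q'"
    "twisted_norm b q' \<le> 5 * twisted_norm b q ^ 4"
proof -
  obtain r t where q: "q = of_int r / of_int t" and t: "t \<noteq> 0" and rt: "coprime r t"
    and rb: "coprime r b" and odd: "odd r" "even t"
    using g unfolding good_reduced_def by blast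
  define r' t' where "r' = (r^2 - b * t^2)^2" and "t' = 4 * r * t * (r^2 + b * t^2)"
  have r: "of_int r = q * of_int t" using q t by simp
  have "of_int t' = 4 * of_int t ^ 4 * (q^3 + of_int b * q)"
    unfolding t'_def by (simp add: r) algebra
  moreover have "of_int r' = of_int t ^ 4 * (q^2 - of_int b)^2"
    unfolding r'_def by (simp add: r) algebra
  ultimately have q': "q' = of_int r' / of_int t'" and "of_int t' \<noteq> (0::rat)"
    unfolding q'_def using t nz by simp_all
  then have t': "t' \<noteq> 0" by simp
  have nr: "\<not> p dvd r" if "prime p" "p dvd r^2 - b * t^2" for p
  proof
    assume "p dvd r"
    then have "p dvd r^2" by (simp add: power2_eq_square)
    then have "p dvd b * t^2" using that(2) by (metis dvd_diff_right_iff)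
    then have "p dvd b \<or> p dvd t" using that(1) prime_dvd_power prime_dvd_mult_iff by blast
    then show False using \<open>p dvd r\<close> rt rb that(1) by (meson coprime_common_divisor not_prime_unit)
  qed
  have od: "odd (r^2 - b * t^2)" using odd by simp
  have cop: "coprime (r^2 - b * t^2) t'"
  proof (rule coprimeI_primes)
    show "r^2 - b * t^2 \<noteq> 0" using od by (metis even_zero)
  next
    fix p assume p: "prime p" "p dvd r^2 - b * t^2"
    then have p2: "p \<noteq> 2" using od by blast
    show "\<not> p dvd t'"
    proof
      assume "p dvd t'"
      moreover have "\<not> p dvd 4" using odd_prime_not_dvd_two[OF p(1) p2] p(1)
        by (metis mult_2 numeral_Bit0 one_add_one prime_dvd_mult_iff numeral_times_numeral semiring_norm(12) semiring_norm(13))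
      ultimately consider "p dvd r" | "p dvd t" | "p dvd r^2 + b * t^2"
        unfolding t'_def using p(1) prime_dvd_mult_iff by metis
      then have "p dvd r^2"
      proof cases
        case 1
        then show ?thesis by (simp add: power2_eq_square)
      next
        case 2
        then have "p dvd b * t^2" by (simp add: power2_eq_square)
        then show ?thesis using p(2) by (metis dvd_diff_left_iff)
      next
        case 3
        then have "p dvd (r^2 + b * t^2) + (r^2 - b * t^2)" using p(2) by (rule dvd_add)
        then have "p dvd 2 * r^2" by simp
        then show ?thesis using odd_prime_not_dvd_two[OF p(1) p2] p(1) prime_dvd_mult_iff by blast
      qed
      then show False using nr[OF p] p(1) prime_dvd_power by blast
    qed
  qed
  then have c': "coprime r' t'" unfolding r'_def by simp
  have "coprime (r^2 - b * t^2) b"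
  proof (rule coprimeI_primes)
    show "r^2 - b * t^2 \<noteq> 0" using od by (metis even_zero)
  next
    fix p assume p: "prime p" "p dvd r^2 - b * t^2"
    show "\<not> p dvd b"
    proof
      assume "p dvd b"
      then have "p dvd r^2" using p(2) by (metis dvd_diff_left_iff dvd_mult2)
      then show False using nr[OF p] p(1) prime_dvd_power by blast
    qed
  qed
  then have "coprime r' b" unfolding r'_def by simp
  then show "good_reduced b q'" unfolding good_reduced_def
    using q' t' c' od by (intro exI[of _ r'] exI[of _ t']) (simp add: r'_def t'_def)
  show "twisted_norm b q ^ 4 \<le> twisted_norm b q'" "twisted_norm b q' \<le> 5 * twisted_norm b q ^ 4"
    using norm_form_doubling[of r b t] twisted_norm_fract[OF rt t, of b]
      twisted_norm_fract[OF c' t', of b]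
    unfolding q(1)[symmetric] q'[symmetric] r'_def[symmetric] t'_def[symmetric] by simp_all
qed

text \<open>The lower inequality has no error term, so \<open>L n / 4 ^ n\<close> increases and its
  limit dominates the term at 0. The upper one bounds it through a geometric series.\<close>

lemma quasi_geometric_limit:
  fixes L :: "nat \<Rightarrow> real"
  assumes low: "\<And>n. 4 * L n \<le> L (Suc n)" and up: "\<And>n. L (Suc n) \<le> 4 * L n + C"
  obtains l where "(\<lambda>n. L n / 4 ^ n) \<longlonglongrightarrow> l" "L 0 \<le> l"
proof -
  define f where "f n = L n / 4 ^ n" for n
  have inc: "incseq f"
    by (rule incseq_SucI) (use low in \<open>simp add: f_def field_simps\<close>)
  have "C \<ge> 0" using low[of 0] up[of 0] by linarith
  have "L n \<le> 4 ^ n * L 0 + (4 ^ n - 1) / 3 * C" for n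
  proof (induction n)
    case (Suc n)
    have "L (Suc n) \<le> 4 * (4 ^ n * L 0 + (4 ^ n - 1) / 3 * C) + C"
      by (intro order_trans[OF up] add_right_mono mult_left_mono Suc) simp
    also have "\<dots> = 4 ^ Suc n * L 0 + (4 ^ Suc n - 1) / 3 * C" by (simp add: field_simps)
    finally show ?case .
  qed simp
  then have "f n \<le> L 0 + C / 3" for n
  proof -
    have "L n \<le> 4 ^ n * L 0 + (4 ^ n - 1) / 3 * C" by fact
    also have "\<dots> \<le> 4 ^ n * (L 0 + C / 3)" using \<open>C \<ge> 0\<close> by (simp add: field_simps)
    finally show ?thesis by (simp add: f_def field_simps)
  qed
  then obtain l where l: "f \<longlonglongrightarrow> l" "\<forall>n. f n \<le> l"
    using incseq_convergent[OF inc] by blast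
  from l(2) have "f 0 \<le> l" by blast
  then show ?thesis using that[of l] l(1) by (simp add: f_def[abs_def])
qed

subsection \<open>The height bound\<close>

text \<open>For the bound, \<open>norm_form_doubling\<close> is applied to \<open>k^2\<close> and
  \<open>s^2\<close> before any cancellation in the second doubling. Cancelling \<open>g\<close>
  then costs a factor \<open>g^4\<close>, which is at most 256.\<close>

lemma quadruple_good_reduced:
  fixes \<xi>0 \<eta>0 \<xi>1 \<eta>1 \<xi>2 :: rat and b :: int
  assumes b: "b \<noteq> 0" and free: "\<And>p. prime p \<Longrightarrow> \<not> int p ^ 4 dvd b"
    and curve0: "\<eta>0^2 = \<xi>0^3 + of_int b * \<xi>0" and "\<eta>0 \<noteq> 0"
    and \<xi>1: "\<xi>1 = (\<xi>0^2 - of_int b)^2 / (4 * (\<xi>0^3 + of_int b * \<xi>0))"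
    and curve1: "\<eta>1^2 = \<xi>1^3 + of_int b * \<xi>1" and "\<eta>1 \<noteq> 0"
    and \<xi>2: "\<xi>2 = (\<xi>1^2 - of_int b)^2 / (4 * (\<xi>1^3 + of_int b * \<xi>1))"
  shows "good_reduced b \<xi>2" "b^4 < 256 * twisted_norm b \<xi>2"
proof -
  obtain k s where ks: "coprime k s" "s > 0"
    and eq: "(\<xi>0^2 - of_int b) / (2 * \<eta>0) = of_int k / of_int s"
    and odd_primes: "\<And>p::int. prime p \<Longrightarrow> p \<noteq> 2 \<Longrightarrow> p dvd k \<Longrightarrow> \<not> p dvd b"
    using first_doubling[OF curve0 \<open>\<eta>0 \<noteq> 0\<close> free] by blast
  define K S :: rat where "K = of_int k" and "S = of_int s"
  have S0: "S \<noteq> 0" using ks by (simp add: S_def)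
  have "\<xi>1 = ((\<xi>0^2 - of_int b) / (2 * \<eta>0))^2"
    unfolding \<xi>1 curve0[symmetric] by (simp add: power_divide power_mult_distrib)
  then have \<xi>1': "\<xi>1 = K^2 / S^2" unfolding eq by (simp add: K_def S_def power_divide)
  have "k \<noteq> 0"
  proof
    assume "k = 0"
    then have "\<xi>1 = 0" unfolding \<xi>1' by (simp add: K_def)
    then show False using curve1 \<open>\<eta>1 \<noteq> 0\<close> by simp
  qed
  then have K0: "K \<noteq> 0" by (simp add: K_def)
  have X: "\<xi>1 * S^2 = K^2" using \<xi>1' S0 by simp
  \<comment> \<open>Clearing denominators in the curve equation at \<open>2P\<close> and dividing by
    \<open>K^2\<close> leaves \<open>k^4 + b s^4\<close>, which is therefore the square of an
    integer.\<close>
  have "(\<eta>1 * S^3 / K)^2 = \<eta>1^2 * S^6 / K^2" by (simp add: power_divide power_mult_distrib)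
  also have "\<eta>1^2 * S^6 = (K^4 + of_int b * S^4) * K^2" unfolding curve1 using X by algebra
  also have "(K^4 + of_int b * S^4) * K^2 / K^2 = of_int (k^4 + b * s^4)"
    using K0 by (simp add: K_def S_def)
  finally have M2: "(\<eta>1 * S^3 / K)^2 = of_int (k^4 + b * s^4)" .
  then obtain m where m: "\<eta>1 * S^3 / K = of_int m" using rat_square_int by blast
  have "of_int (m^2) = (of_int (k^4 + b * s^4) :: rat)" using M2 unfolding m by simp
  then have m2: "m^2 = k^4 + b * s^4" by (simp only: of_int_eq_iff)
  have "of_int m \<noteq> (0::rat)" unfolding m[symmetric] using K0 S0 \<open>\<eta>1 \<noteq> 0\<close> by simp
  then have m0: "m \<noteq> 0" by simp
  have b16: "\<not> 16 dvd b" using free[of 2] by simp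
  obtain g n d where g: "g \<in> {1, 2, 4}" and gn: "k^4 - b * s^4 = g * n"
    and gd: "2 * k * s * m = g * d" and nd: "odd n" "even d" "coprime n d" "coprime n b"
    by (rule second_doubling[OF ks(1) m2 b16 odd_primes])
  have g0: "g \<noteq> 0" using g by auto
  have d0: "d \<noteq> 0" using gd \<open>k \<noteq> 0\<close> ks(2) m0 by auto
  have "\<eta>1 * S^3 = K * of_int m" using m K0 by (simp add: field_simps)
  then have "\<xi>2 * (2 * K * S * of_int m)^2 = \<xi>2 * (4 * \<eta>1^2) * S^8"
    by algebra
  also have "\<xi>2 * (4 * \<eta>1^2) = (\<xi>1^2 - of_int b)^2"
    unfolding \<xi>2 curve1[symmetric] using \<open>\<eta>1 \<noteq> 0\<close> by simp
  also have "(\<xi>1^2 - of_int b)^2 * S^8 = (K^4 - of_int b * S^4)^2" using X by algebra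
  finally have "\<xi>2 * (of_int (2 * k * s * m))^2 = (of_int (k^4 - b * s^4))^2"
    by (simp add: K_def S_def)
  then have "of_int g^2 * (\<xi>2 * of_int (d^2)) = of_int g^2 * of_int (n^2)"
    unfolding gn gd by (simp add: power_mult_distrib mult_ac)
  then have "\<xi>2 * of_int (d^2) = of_int (n^2)" using g0 by simp
  then have fr: "\<xi>2 = of_int (n^2) / of_int (d^2)" using d0 by (simp add: field_simps)
  have cop: "coprime (n^2) (d^2)" "d^2 \<noteq> 0" using nd d0 by simp_all
  show "good_reduced b \<xi>2" unfolding good_reduced_def
    using fr nd d0 by (intro exI[of _ "n^2"] exI[of _ "d^2"]) simp
  define N where "N = twisted_norm b \<xi>2"
  have N: "N = (n^2)^2 + \<bar>b\<bar> * (d^2)^2" unfolding N_def fr by (rule twisted_norm_fract[OF cop])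
  have "N \<ge> 0" unfolding N by simp
  \<comment> \<open>\<open>s \<ge> 1\<close> and \<open>k \<noteq> 0\<close>: the source of the
    strict inequality in the theorem.\<close>
  have "\<bar>b\<bar> * 1 \<le> \<bar>b\<bar> * s^4" using ks(2) by (intro mult_left_mono) auto
  moreover have "k^4 > 0" using \<open>k \<noteq> 0\<close> by (simp add: zero_less_power_eq)
  ultimately have "\<bar>b\<bar> < k^4 + \<bar>b\<bar> * s^4" by linarith
  then have "\<bar>b\<bar> < (k^2)^2 + \<bar>b\<bar> * (s^2)^2" by simp
  then have "\<bar>b\<bar>^4 < ((k^2)^2 + \<bar>b\<bar> * (s^2)^2)^4" by (intro power_strict_mono) auto
  also have "\<dots> \<le> (((k^2)^2 - b * (s^2)^2)^2)^2 + \<bar>b\<bar> * (4 * k^2 * s^2 * ((k^2)^2 + b * (s^2)^2))^2"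
    by (rule norm_form_doubling)
  also have "\<dots> = (k^4 - b * s^4)^4 + \<bar>b\<bar> * (2 * k * s * m)^4"
    using m2 by algebra
  also have "\<dots> = g^4 * N" unfolding gn gd N by algebra
  also have "\<dots> \<le> 256 * N" using g \<open>N \<ge> 0\<close> by (intro mult_right_mono) auto
  finally show "b^4 < 256 * twisted_norm b \<xi>2" unfolding N_def by simp
qed

section \<open>Iterated doubling of a nontorsion point\<close>

lemma curve_E_eq_short_weierstrass: "curve_E a = short_weierstrass (of_int a) 0"
  by (simp add: curve_E_def short_weierstrass_def)

lemma nonsingular_curve_E: "a \<noteq> 0 \<Longrightarrow> nonsingular_short (of_int a :: rat) 0"
  by unfold_locales simp

lemma doubling_curve_E:
  assumes "a \<noteq> 0" and curve: "y^2 = x^3 + of_int a * x" and y: "y \<noteq> 0"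
  obtains y' where "point_add (curve_E a) (Affine x y) (Affine x y) =
    Affine ((x^2 - of_int a)^2 / (4 * (x^3 + of_int a * x))) y'"
proof -
  interpret nonsingular_short "of_int a :: rat" 0 using nonsingular_curve_E[OF \<open>a \<noteq> 0\<close>] .
  have "(3 * x^2 + of_int a)^2 = (x^2 - of_int a)^2 + 8 * x * y^2" unfolding curve by algebra
  then have "((3 * x^2 + of_int a) / (2 * y))^2 - x - x = (x^2 - of_int a)^2 / (4 * y^2)"
    using y by (simp add: power_divide power_mult_distrib field_simps)
  then show ?thesis using that y
    unfolding curve_E_eq_short_weierstrass add_affine curve[symmetric] by (simp add: Let_def)
qed

text \<open>\<open>point_mult\<close> adds \<open>P\<close> one copy at a time;
  \<open>mult_double\<close>, and with it associativity, makes the multiples by powers of two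
  iterated doublings. A zero ordinate would send the next one to \<open>Infinity\<close>.\<close>

lemma nontorsion_doubling_sequence:
  assumes a: "a \<noteq> 0" and P: "P \<in> curve_points (curve_E a)" and nt: "\<not> torsion_point (curve_E a) P"
  obtains x y :: "nat \<Rightarrow> rat" where "\<And>n. point_mult (curve_E a) (2 ^ n) P = Affine (x n) (y n)"
    "\<And>n. y n \<noteq> 0" "\<And>n. y n ^ 2 = x n ^ 3 + of_int a * x n"
    "\<And>n. x (Suc n) = (x n ^ 2 - of_int a)^2 / (4 * (x n ^ 3 + of_int a * x n))"
proof -
  interpret nonsingular_short "of_int a :: rat" 0 using nonsingular_curve_E[OF a] .
  let ?E = "short_weierstrass (of_int a :: rat) 0"
  have eq: "curve_E a = ?E" by (rule curve_E_eq_short_weierstrass)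
  have oP: "on_curve ?E P" using P by (simp add: curve_points_def eq)
  have ninf: "point_mult ?E n P \<noteq> Infinity" if "n > 0" for n
    using nt that unfolding torsion_point_def eq by blast
  have "\<exists>z. point_mult ?E (2 ^ n) P = Affine (fst z) (snd z)" for n
    using ninf[of "2 ^ n"] by (cases "point_mult ?E (2 ^ n) P") auto
  then obtain z where z: "\<And>n. point_mult ?E (2 ^ n) P = Affine (fst (z n)) (snd (z n))" by metis
  define x y where "x n = fst (z n)" and "y n = snd (z n)" for n
  have xy: "point_mult ?E (2 ^ n) P = Affine (x n) (y n)" for n using z by (simp add: x_def y_def)
  have curve: "y n ^ 2 = x n ^ 3 + of_int a * x n" for n
    using on_curve_mult[OF oP, of "2 ^ n"] unfolding xy on_curve_affine by simp
  have double: "Affine (x (Suc n)) (y (Suc n)) = point_add ?E (Affine (x n) (y n)) (Affine (x n) (y n))" for n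
    using mult_double[OF oP, of "2 ^ n"] xy[of "Suc n"] xy[of n] by simp
  have y: "y n \<noteq> 0" for n
  proof
    assume "y n = 0"
    then have "point_add ?E (Affine (x n) (y n)) (Affine (x n) (y n)) = Infinity" by (simp add: add_affine)
    with double[of n] show False by simp
  qed
  have "x (Suc n) = (x n ^ 2 - of_int a)^2 / (4 * (x n ^ 3 + of_int a * x n))" for n
    using doubling_curve_E[OF a curve[of n] y[of n]] double[of n] unfolding eq by (metis point.inject)
  then show ?thesis using that[of x y] xy y curve unfolding eq by blast
qed

theorem corollary1p4:
  fixes a :: int and P :: "rat point"
  assumes "a \<noteq> 0"
    and "P \<in> curve_points (curve_E a)"
    and "\<not> torsion_point (curve_E a) P"
  shows "canonical_height (curve_E a) P
           > 1 / 48 * ln (real (minimal_discriminant (curve_E a))) - ln 2 / 4"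
proof -
  obtain w b where a: "a = w ^ 4 * b" and w: "w > 0" and b: "b \<noteq> 0"
    and free: "\<And>p. prime p \<Longrightarrow> \<not> int p ^ 4 dvd b"
    using fourth_power_free_decomposition[OF \<open>a \<noteq> 0\<close>] by blast
  obtain x y where xy: "\<And>n. point_mult (curve_E a) (2 ^ n) P = Affine (x n) (y n)"
    "\<And>n. y n \<noteq> 0" "\<And>n. y n ^ 2 = x n ^ 3 + of_int a * x n"
    "\<And>n. x (Suc n) = (x n ^ 2 - of_int a)^2 / (4 * (x n ^ 3 + of_int a * x n))"
    using nontorsion_doubling_sequence[OF assms] by blast
  define \<omega> :: rat where "\<omega> = of_int w"
  have \<omega>: "\<omega> \<noteq> 0" using w by (simp add: \<omega>_def)
  have a': "of_int a = \<omega>^4 * of_int b" by (simp add: a \<omega>_def)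
  \<comment> \<open>Dividing by \<open>w^2\<close> and \<open>w^3\<close> moves the points to the
    minimal equation \<open>y^2 = x^3 + b x\<close>.\<close>
  define \<xi> \<eta> where "\<xi> n = x n / \<omega>^2" and "\<eta> n = y n / \<omega>^3" for n
  have x: "x n = \<omega>^2 * \<xi> n" for n using \<omega> by (simp add: \<xi>_def)
  have cubic: "x n ^ 3 + of_int a * x n = \<omega>^6 * (\<xi> n ^ 3 + of_int b * \<xi> n)" for n
    unfolding x a' by algebra
  have curve: "\<eta> n ^ 2 = \<xi> n ^ 3 + of_int b * \<xi> n" for n
    using xy(3)[of n] \<omega> unfolding cubic \<eta>_def by (simp add: power_divide flip: power_mult)
  have \<eta>: "\<eta> n \<noteq> 0" for n using xy(2)[of n] \<omega> by (simp add: \<eta>_def)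
  have step: "\<xi> (Suc n) = (\<xi> n ^ 2 - of_int b)^2 / (4 * (\<xi> n ^ 3 + of_int b * \<xi> n))" for n
  proof -
    have "(x n ^ 2 - of_int a)^2 = \<omega>^8 * (\<xi> n ^ 2 - of_int b)^2" unfolding x a' by algebra
    then have "x (Suc n) = (\<omega>^8 * (\<xi> n ^ 2 - of_int b)^2) / (\<omega>^6 * (4 * (\<xi> n ^ 3 + of_int b * \<xi> n)))"
      unfolding xy(4) cubic by (simp add: mult_ac)
    also have "\<dots> = \<omega>^2 * ((\<xi> n ^ 2 - of_int b)^2 / (4 * (\<xi> n ^ 3 + of_int b * \<xi> n)))"
    proof -
      have "(\<omega>^8 * A) / (\<omega>^6 * B) = \<omega>^2 * (A / B)" for A B
      proof -
        have "\<omega>^8 * A = \<omega>^6 * (\<omega>^2 * A)" by algebra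
        then have "(\<omega>^8 * A) / (\<omega>^6 * B) = (\<omega>^6 * (\<omega>^2 * A)) / (\<omega>^6 * B)" by (simp only:)
        also have "\<dots> = (\<omega>^2 * A) / B" using \<omega> by (intro mult_divide_mult_cancel_left) simp
        finally show ?thesis by simp
      qed
      then show ?thesis .
    qed
    finally show ?thesis using \<omega> by (simp add: \<xi>_def)
  qed
  have nz: "\<xi> n ^ 3 + of_int b * \<xi> n \<noteq> 0" for n using \<eta>[of n] curve[of n] by auto
  have two: "good_reduced b (\<xi> 2)" "b^4 < 256 * twisted_norm b (\<xi> 2)"
    using quadruple_good_reduced[OF b free curve[of 0] \<eta>[of 0] step[of 0] curve[of "Suc 0"] \<eta>[of "Suc 0"]
        step[of "Suc 0"]] by (simp_all add: numeral_2_eq_2)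
  have good: "good_reduced b (\<xi> (n + 2))" for n
  proof (induction n)
    case (Suc n)
    then show ?case using good_reduced_doubling(1)[OF Suc nz] step[of "n + 2"] by simp
  qed (use two in \<open>simp add: numeral_2_eq_2\<close>)
  \<comment> \<open>The shift by 2 starts the sequence at \<open>4P\<close>, from where on no
    doubling cancels anything.\<close>
  define L where "L n = ln (real_of_int (twisted_norm b (\<xi> (n + 2))))" for n
  have pos: "real_of_int (twisted_norm b q) > 0" for q using twisted_norm_pos[OF b] by simp
  have norm_step: "twisted_norm b (\<xi> (n + 2)) ^ 4 \<le> twisted_norm b (\<xi> (Suc n + 2))"
    "twisted_norm b (\<xi> (Suc n + 2)) \<le> 5 * twisted_norm b (\<xi> (n + 2)) ^ 4" for n
    using good_reduced_doubling(2,3)[OF good nz, of n] step[of "n + 2"] by simp_all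
  have "4 * L n \<le> L (Suc n)" for n
  proof -
    have "real_of_int (twisted_norm b (\<xi> (n + 2)) ^ 4) \<le> real_of_int (twisted_norm b (\<xi> (Suc n + 2)))"
      using norm_step(1)[of n] by (simp only: of_int_le_iff)
    then have "ln (real_of_int (twisted_norm b (\<xi> (n + 2))) ^ 4) \<le> L (Suc n)"
      unfolding L_def of_int_power by (rule ln_mono) (intro zero_less_power pos)
    then show ?thesis by (simp add: ln_realpow L_def)
  qed
  moreover have "L (Suc n) \<le> 4 * L n + ln 5" for n
  proof -
    have "L (Suc n) \<le> ln (real_of_int (5 * twisted_norm b (\<xi> (n + 2)) ^ 4))"
      unfolding L_def using norm_step(2)[of n] pos by (intro ln_mono) (simp_all only: of_int_le_iff)
    also have "\<dots> = ln 5 + 4 * L n" using pos[of "\<xi> (n + 2)"]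
      by (simp add: ln_mult_pos ln_realpow L_def)
    finally show ?thesis by simp
  qed
  ultimately obtain l where l: "(\<lambda>n. L n / 4 ^ n) \<longlonglongrightarrow> l" "L 0 \<le> l"
    using quasi_geometric_limit[of L "ln 5"] by blast
  define h where "h n = rat_height (x n)" for n
  define C where "C = ln (1 + real_of_int \<bar>b\<bar>) / 2 + ln (real_of_int (w^2))"
  have close: "\<bar>h (n + 2) - L n / 2\<bar> \<le> C" for n
  proof -
    have "w^2 > 0" using w by simp
    then have w1: "max \<bar>w^2\<bar> \<bar>1\<bar> = w^2" "max \<bar>1\<bar> \<bar>w^2\<bar> = w^2" by linarith+
    have "x (n + 2) = of_int (w^2) / of_int 1 * \<xi> (n + 2)" by (simp add: x \<omega>_def)
    then have "h (n + 2) \<le> ln (real_of_int (w^2)) + rat_height (\<xi> (n + 2))"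
      using rat_height_scale_le[of "w^2" 1 "\<xi> (n + 2)"] w unfolding w1 h_def by simp
    moreover have "\<xi> (n + 2) = of_int 1 / of_int (w^2) * x (n + 2)"
      by (simp add: \<xi>_def \<omega>_def)
    then have "rat_height (\<xi> (n + 2)) \<le> ln (real_of_int (w^2)) + h (n + 2)"
      using rat_height_scale_le[of 1 "w^2" "x (n + 2)"] w unfolding w1 h_def by simp
    ultimately show ?thesis
      using rat_height_twisted_norm[OF b, of "\<xi> (n + 2)"] unfolding C_def L_def by linarith
  qed
  have "(\<lambda>n. (h (n + 2) - L n / 2) / 4 ^ n) \<longlonglongrightarrow> 0"
  proof (rule tendsto_0_le)
    show "(\<lambda>n. C / 4 ^ n) \<longlonglongrightarrow> 0"
      using tendsto_mult[OF tendsto_const[of C] LIMSEQ_inverse_realpow_zero[of 4]]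
      by (simp add: divide_inverse)
    have "\<bar>h (n + 2) - L n / 2\<bar> \<le> \<bar>C\<bar>" for n using close[of n] by linarith
    then show "\<forall>\<^sub>F n in sequentially. norm ((h (n + 2) - L n / 2) / 4 ^ n) \<le> norm (C / 4 ^ n) * 1"
      by (intro always_eventually allI) (simp add: divide_right_mono)
  qed
  then have "(\<lambda>n. (h (n + 2) - L n / 2) / 4 ^ n + L n / 4 ^ n / 2) \<longlonglongrightarrow> 0 + l / 2"
    using l(1) by (intro tendsto_intros) auto
  then have "(\<lambda>n. h (n + 2) / 4 ^ n) \<longlonglongrightarrow> l / 2" by (simp add: diff_divide_distrib)
  \<comment> \<open>The shift by 2 costs \<open>4^2 = 16\<close>, and the height is about half of
    \<open>L\<close>, whence \<open>l / 32\<close>; the factor \<open>1 / 2\<close> in the canonical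
    height then gives \<open>l / 64\<close>.\<close>
  then have "(\<lambda>n. h (n + 2) / 4 ^ n / 16) \<longlonglongrightarrow> l / 2 / 16"
    by (rule tendsto_divide[OF _ tendsto_const]) simp
  then have "(\<lambda>n. h (n + 2) / 4 ^ (n + 2)) \<longlonglongrightarrow> l / 32" by (simp add: mult.commute)
  then have "(\<lambda>n. h n / 4 ^ n) \<longlonglongrightarrow> l / 32" by (rule LIMSEQ_offset)
  then have ch: "canonical_height (curve_E a) P = l / 64"
    unfolding canonical_height_def xy(1) by (simp add: h_def limI)
  have "real_of_int (b^4) < real_of_int (256 * twisted_norm b (\<xi> 2))"
    using two(2) by (simp only: of_int_less_iff)
  then have "ln (real_of_int (b^4)) < ln (real_of_int (256 * twisted_norm b (\<xi> 2)))"
    using b by (intro ln_strict_mono) (simp_all add: zero_less_power_eq)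
  also have "\<dots> = ln (2 ^ 8) + L 0"
    using pos[of "\<xi> 2"] by (simp add: ln_mult_pos L_def numeral_2_eq_2)
  also have "\<dots> \<le> 8 * ln 2 + l" using l(2) by (subst ln_realpow) simp
  also have "ln (real_of_int (b^4)) = ln (\<bar>real_of_int b\<bar> ^ 4)" by simp
  also have "\<dots> = 4 * ln \<bar>real_of_int b\<bar>" by (subst ln_realpow) simp
  finally have main: "4 * ln \<bar>real_of_int b\<bar> < 8 * ln 2 + l" .
  \<comment> \<open>As \<open>64 = 2^6\<close>, the right-hand side of the theorem equals
    \<open>ln |b| / 16 - ln 2 / 8\<close>, and the claim is \<open>main\<close> divided by
    64.\<close>
  have "real (minimal_discriminant (curve_E a)) = 2 ^ 6 * \<bar>real_of_int b\<bar> ^ 3"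
    using minimal_discriminant_curve_E[OF a _ b free] w by simp
  then have "ln (real (minimal_discriminant (curve_E a))) = ln (2 ^ 6) + ln (\<bar>real_of_int b\<bar> ^ 3)"
    using b by (simp add: ln_mult_pos)
  also have "\<dots> = 6 * ln 2 + 3 * ln \<bar>real_of_int b\<bar>" by (simp only: ln_realpow of_nat_numeral)
  finally have "ln (real (minimal_discriminant (curve_E a))) = 6 * ln 2 + 3 * ln \<bar>real_of_int b\<bar>" .
  then show ?thesis unfolding ch using main by linarith
qed

end
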